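(* Let $n\in\mathbb{N}^*$ and let $\mathcal{T}$ be a decidable theory such that $\mathcal{T}\sqcup\mathcal{T}'$ is decidable for every decidable $n$-shiny theory $\mathcal{T}'$. Then $\mathcal{T}$ is $n$-decidable.
   Context: All logic is one-sorted first-order logic with equality, and all signatures are countable. A $\Sigma$-theory is a set of $\Sigma$-sentences; a $\mathcal{T}$-interpretation is a $\Sigma$-structure (nonempty domain) with a variable assignment satisfying all axioms of $\mathcal{T}$. $\mathcal{T}$ is decidable if there is an algorithm deciding, for a quantifier-free $\Sigma$-formula, whether some $\mathcal{T}$-interpretation satisfies it. The disjoint combination $\mathcal{T}_1\sqcup\mathcal{T}_2$ is the theory over the disjoint union of the signatures (renamed to share only equality) axiomatized by the union of the axioms. Let $\mathbb{N}^*=\{1,2,\dots\}$, $\mathbb{N}_\omega=\mathbb{N}\cup\{\aleph_0\}$. For quantifier-free $\varphi$, $\mathrm{Spec}_{\mathcal{T}}(\varphi)$ is the set of $m\in\mathbb{N}_\omega$ such that some $\mathcal{T}$-interpretation with domain of cardinality $m$ satisfies $\varphi$. A theory $\mathcal{T}$ is $n$-decidable if there is an algorithm that, given a quantifier-free $\varphi$, decides whether $n\in\mathrm{Spec}_{\mathcal{T}}(\varphi)$. A decidable theory $\mathcal{T}$ is $n$-shiny if there is an algorithm that, given a $\mathcal{T}$-satisfiable quantifier-free $\varphi$, returns a pair $(t,k)$ with $t\in\{0,1,2\}$ and $k\in\mathbb{N}^*$ such that: if $t=0$ then $\mathrm{Spec}_{\mathcal{T}}(\varphi)=\{n\}$;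 if $t=1$ then $\mathrm{Spec}_{\mathcal{T}}(\varphi)=\{n\}\cup\{m\in\mathbb{N}_\omega: m\ge k\}$; if $t=2$ then $\mathrm{Spec}_{\mathcal{T}}(\varphi)=\{m\in\mathbb{N}_\omega: m\ge k\}$. *)

theory Defs
  imports
    "HOL-Library.Nat_Bijection"
    "HOL-Library.Countable_Set"
    "HOL-Library.Extended_Nat"
    "HOL-Library.Infinite_Typeclass"
begin

text \<open>
  Symbols are named by natural numbers. This covers all countable signatures and provides the
  numbering of the symbols that is needed to feed formulas to algorithms. The set of symbols and
  the arity functions are arbitrary (not necessarily computable); arities of numbers outside the
  symbol sets are irrelevant.
\<close>

record signature =
  fsyms :: "nat set"
  farity :: "nat \<Rightarrow> nat"
  psyms :: "nat set"
  parity :: "nat \<Rightarrow> nat"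

datatype tm = Var nat | Fun nat "tm list"

datatype fm =
    Eq tm tm
  | Pred nat "tm list"
  | Neg fm
  | Conj fm fm
  | Disj fm fm
  | Imp fm fm
  | All nat fm
  | Ex nat fm

fun wf_tm :: "signature \<Rightarrow> tm \<Rightarrow> bool" where
  "wf_tm \<Sigma> (Var x) \<longleftrightarrow> True"
| "wf_tm \<Sigma> (Fun f ts) \<longleftrightarrow>
     f \<in> fsyms \<Sigma> \<and> length ts = farity \<Sigma> f \<and> list_all (wf_tm \<Sigma>) ts"

primrec wf_fm :: "signature \<Rightarrow> fm \<Rightarrow> bool" where
  "wf_fm \<Sigma> (Eq s t) \<longleftrightarrow> wf_tm \<Sigma> s \<and> wf_tm \<Sigma> t"
| "wf_fm \<Sigma> (Pred p ts) \<longleftrightarrow>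
     p \<in> psyms \<Sigma> \<and> length ts = parity \<Sigma> p \<and> list_all (wf_tm \<Sigma>) ts"
| "wf_fm \<Sigma> (Neg \<phi>) \<longleftrightarrow> wf_fm \<Sigma> \<phi>"
| "wf_fm \<Sigma> (Conj \<phi> \<psi>) \<longleftrightarrow> wf_fm \<Sigma> \<phi> \<and> wf_fm \<Sigma> \<psi>"
| "wf_fm \<Sigma> (Disj \<phi> \<psi>) \<longleftrightarrow> wf_fm \<Sigma> \<phi> \<and> wf_fm \<Sigma> \<psi>"
| "wf_fm \<Sigma> (Imp \<phi> \<psi>) \<longleftrightarrow> wf_fm \<Sigma> \<phi> \<and> wf_fm \<Sigma> \<psi>"
| "wf_fm \<Sigma> (All x \<phi>) \<longleftrightarrow> wf_fm \<Sigma> \<phi>"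
| "wf_fm \<Sigma> (Ex x \<phi>) \<longleftrightarrow> wf_fm \<Sigma> \<phi>"

primrec fv_tm :: "tm \<Rightarrow> nat set" where
  "fv_tm (Var x) = {x}"
| "fv_tm (Fun f ts) = \<Union> (set (map fv_tm ts))"

primrec fv_fm :: "fm \<Rightarrow> nat set" where
  "fv_fm (Eq s t) = fv_tm s \<union> fv_tm t"
| "fv_fm (Pred p ts) = (\<Union>t\<in>set ts. fv_tm t)"
| "fv_fm (Neg \<phi>) = fv_fm \<phi>"
| "fv_fm (Conj \<phi> \<psi>) = fv_fm \<phi> \<union> fv_fm \<psi>"
| "fv_fm (Disj \<phi> \<psi>) = fv_fm \<phi> \<union> fv_fm \<psi>"
| "fv_fm (Imp \<phi> \<psi>) = fv_fm \<phi> \<union> fv_fm \<psi>"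
| "fv_fm (All x \<phi>) = fv_fm \<phi> - {x}"
| "fv_fm (Ex x \<phi>) = fv_fm \<phi> - {x}"

primrec quantifier_free :: "fm \<Rightarrow> bool" where
  "quantifier_free (Eq s t) \<longleftrightarrow> True"
| "quantifier_free (Pred p ts) \<longleftrightarrow> True"
| "quantifier_free (Neg \<phi>) \<longleftrightarrow> quantifier_free \<phi>"
| "quantifier_free (Conj \<phi> \<psi>) \<longleftrightarrow> quantifier_free \<phi> \<and> quantifier_free \<psi>"
| "quantifier_free (Disj \<phi> \<psi>) \<longleftrightarrow> quantifier_free \<phi> \<and> quantifier_free \<psi>"
| "quantifier_free (Imp \<phi> \<psi>) \<longleftrightarrow> quantifier_free \<phi> \<and> quantifier_free \<psi>"
| "quantifier_free (All x \<phi>) \<longleftrightarrow> False"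
| "quantifier_free (Ex x \<phi>) \<longleftrightarrow> False"

definition qf_fms :: "signature \<Rightarrow> fm set" where
  "qf_fms \<Sigma> = {\<phi>. wf_fm \<Sigma> \<phi> \<and> quantifier_free \<phi>}"

definition sentences :: "signature \<Rightarrow> fm set" where
  "sentences \<Sigma> = {\<phi>. wf_fm \<Sigma> \<phi> \<and> fv_fm \<phi> = {}}"

record fo_theory =
  sig :: signature
  axioms :: "fm set"

definition is_theory :: "fo_theory \<Rightarrow> bool" where
  "is_theory T \<longleftrightarrow> axioms T \<subseteq> sentences (sig T)"

record 'u fo_struct =
  domain :: "'u set"
  fint :: "nat \<Rightarrow> 'u list \<Rightarrow> 'u"
  pint :: "nat \<Rightarrow> 'u list \<Rightarrow> bool"

definition is_struct :: "signature \<Rightarrow> 'u fo_struct \<Rightarrow> bool" where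
  "is_struct \<Sigma> M \<longleftrightarrow> domain M \<noteq> {} \<and>
     (\<forall>f \<in> fsyms \<Sigma>. \<forall>xs. length xs = farity \<Sigma> f \<and> set xs \<subseteq> domain M \<longrightarrow> fint M f xs \<in> domain M)"

primrec eval_tm :: "'u fo_struct \<Rightarrow> (nat \<Rightarrow> 'u) \<Rightarrow> tm \<Rightarrow> 'u" where
  "eval_tm M v (Var x) = v x"
| "eval_tm M v (Fun f ts) = fint M f (map (eval_tm M v) ts)"

primrec sat :: "'u fo_struct \<Rightarrow> (nat \<Rightarrow> 'u) \<Rightarrow> fm \<Rightarrow> bool" where
  "sat M v (Eq s t) \<longleftrightarrow> eval_tm M v s = eval_tm M v t"
| "sat M v (Pred p ts) \<longleftrightarrow> pint M p (map (eval_tm M v) ts)"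
| "sat M v (Neg \<phi>) \<longleftrightarrow> \<not> sat M v \<phi>"
| "sat M v (Conj \<phi> \<psi>) \<longleftrightarrow> sat M v \<phi> \<and> sat M v \<psi>"
| "sat M v (Disj \<phi> \<psi>) \<longleftrightarrow> sat M v \<phi> \<or> sat M v \<psi>"
| "sat M v (Imp \<phi> \<psi>) \<longleftrightarrow> (sat M v \<phi> \<longrightarrow> sat M v \<psi>)"
| "sat M v (All x \<phi>) \<longleftrightarrow> (\<forall>a \<in> domain M. sat M (v(x := a)) \<phi>)"
| "sat M v (Ex x \<phi>) \<longleftrightarrow> (\<exists>a \<in> domain M. sat M (v(x := a)) \<phi>)"

definition interpretation_of :: "fo_theory \<Rightarrow> 'u fo_struct \<Rightarrow> (nat \<Rightarrow> 'u) \<Rightarrow> bool" where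
  "interpretation_of T M v \<longleftrightarrow>
     is_struct (sig T) M \<and> range v \<subseteq> domain M \<and> (\<forall>\<psi> \<in> axioms T. sat M v \<psi>)"

text \<open>
  HOL cannot quantify over all types inside a formula, so the domains of interpretations are the
  nonempty subsets of an arbitrary infinite type \<^typ>\<open>'u\<close>, passed as a type argument. The
  choice of \<^typ>\<open>'u\<close> is immaterial; see \<open>satisfiable_universe\<close>, \<open>Spec_universe\<close>
  and their corollaries below.
\<close>

definition satisfiable :: "'u itself \<Rightarrow> fo_theory \<Rightarrow> fm \<Rightarrow> bool" where
  "satisfiable _ T \<phi> \<longleftrightarrow> (\<exists>(M :: 'u fo_struct) v. interpretation_of T M v \<and> sat M v \<phi>)"

text \<open>The set $\mathbb{N} \cup \{\aleph_0\}$ is rendered as \<^typ>\<open>enat\<close>, with \<open>\<infinity>\<close> in the role of $\aleph_0$.\<close>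

fun has_card :: "'u set \<Rightarrow> enat \<Rightarrow> bool" where
  "has_card A (enat m) \<longleftrightarrow> finite A \<and> card A = m"
| "has_card A \<infinity> \<longleftrightarrow> infinite A \<and> countable A"

definition Spec :: "'u itself \<Rightarrow> fo_theory \<Rightarrow> fm \<Rightarrow> enat set" where
  "Spec _ T \<phi> = {m. \<exists>(M :: 'u fo_struct) v.
     interpretation_of T M v \<and> has_card (domain M) m \<and> sat M v \<phi>}"

text \<open>
  The disjoint union of two signatures is obtained by renaming every symbol \<open>k\<close> of the first to
  \<^term>\<open>sum_encode (Inl k)\<close> \<open>= 2 * k\<close> and every symbol \<open>k\<close> of the second to
  \<^term>\<open>sum_encode (Inr k)\<close> \<open>= 2 * k + 1\<close>.
\<close>

primrec rename_tm :: "(nat \<Rightarrow> nat) \<Rightarrow> tm \<Rightarrow> tm" where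
  "rename_tm r (Var x) = Var x"
| "rename_tm r (Fun f ts) = Fun (r f) (map (rename_tm r) ts)"

primrec rename_fm :: "(nat \<Rightarrow> nat) \<Rightarrow> fm \<Rightarrow> fm" where
  "rename_fm r (Eq s t) = Eq (rename_tm r s) (rename_tm r t)"
| "rename_fm r (Pred p ts) = Pred (r p) (map (rename_tm r) ts)"
| "rename_fm r (Neg \<phi>) = Neg (rename_fm r \<phi>)"
| "rename_fm r (Conj \<phi> \<psi>) = Conj (rename_fm r \<phi>) (rename_fm r \<psi>)"
| "rename_fm r (Disj \<phi> \<psi>) = Disj (rename_fm r \<phi>) (rename_fm r \<psi>)"
| "rename_fm r (Imp \<phi> \<psi>) = Imp (rename_fm r \<phi>) (rename_fm r \<psi>)"
| "rename_fm r (All x \<phi>) = All x (rename_fm r \<phi>)"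
| "rename_fm r (Ex x \<phi>) = Ex x (rename_fm r \<phi>)"

definition inj_left :: "nat \<Rightarrow> nat" where
  "inj_left k = sum_encode (Inl k)"

definition inj_right :: "nat \<Rightarrow> nat" where
  "inj_right k = sum_encode (Inr k)"

definition disjoint_sig :: "signature \<Rightarrow> signature \<Rightarrow> signature" where
  "disjoint_sig \<Sigma>1 \<Sigma>2 = \<lparr>
     fsyms = inj_left ` fsyms \<Sigma>1 \<union> inj_right ` fsyms \<Sigma>2,
     farity = (\<lambda>k. case_sum (farity \<Sigma>1) (farity \<Sigma>2) (sum_decode k)),
     psyms = inj_left ` psyms \<Sigma>1 \<union> inj_right ` psyms \<Sigma>2,
     parity = (\<lambda>k. case_sum (parity \<Sigma>1) (parity \<Sigma>2) (sum_decode k))\<rparr>"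

definition disjoint_combination :: "fo_theory \<Rightarrow> fo_theory \<Rightarrow> fo_theory" (infixl "\<squnion>" 65) where
  "T1 \<squnion> T2 = \<lparr>
     sig = disjoint_sig (sig T1) (sig T2),
     axioms = rename_fm inj_left ` axioms T1 \<union> rename_fm inj_right ` axioms T2\<rparr>"

text \<open>
  Algorithms are programs for partial recursive functions; \<open>computes p xs y\<close> says that \<open>p\<close>
  terminates on the input tuple \<open>xs\<close> with output \<open>y\<close>.
\<close>

datatype recf =
    Zero
  | Succ
  | Proj nat
  | Comp recf "recf list"
  | PRec recf recf
  | Mu recf

inductive computes :: "recf \<Rightarrow> nat list \<Rightarrow> nat \<Rightarrow> bool" where
  Zero: "computes Zero xs 0"
| Succ: "computes Succ [x] (Suc x)"
| Proj: "i < length xs \<Longrightarrow> computes (Proj i) xs (xs ! i)"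
| Comp: "length ys = length gs \<Longrightarrow> (\<And>i. i < length gs \<Longrightarrow> computes (gs ! i) xs (ys ! i)) \<Longrightarrow>
    computes f ys z \<Longrightarrow> computes (Comp f gs) xs z"
| PRec_0: "computes f xs y \<Longrightarrow> computes (PRec f g) (0 # xs) y"
| PRec_Suc: "computes (PRec f g) (k # xs) y \<Longrightarrow> computes g (k # y # xs) z \<Longrightarrow>
    computes (PRec f g) (Suc k # xs) z"
| Mu: "computes f (k # xs) 0 \<Longrightarrow> (\<And>i. i < k \<Longrightarrow> \<exists>y. computes f (i # xs) (Suc y)) \<Longrightarrow>
    computes (Mu f) xs k"

primrec code_tm :: "tm \<Rightarrow> nat" where
  "code_tm (Var x) = prod_encode (0, x)"
| "code_tm (Fun f ts) = prod_encode (1, prod_encode (f, list_encode (map code_tm ts)))"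

primrec code_fm :: "fm \<Rightarrow> nat" where
  "code_fm (Eq s t) = prod_encode (0, prod_encode (code_tm s, code_tm t))"
| "code_fm (Pred p ts) = prod_encode (1, prod_encode (p, list_encode (map code_tm ts)))"
| "code_fm (Neg \<phi>) = prod_encode (2, code_fm \<phi>)"
| "code_fm (Conj \<phi> \<psi>) = prod_encode (3, prod_encode (code_fm \<phi>, code_fm \<psi>))"
| "code_fm (Disj \<phi> \<psi>) = prod_encode (4, prod_encode (code_fm \<phi>, code_fm \<psi>))"
| "code_fm (Imp \<phi> \<psi>) = prod_encode (5, prod_encode (code_fm \<phi>, code_fm \<psi>))"
| "code_fm (All x \<phi>) = prod_encode (6, prod_encode (x, code_fm \<phi>))"
| "code_fm (Ex x \<phi>) = prod_encode (7, prod_encode (x, code_fm \<phi>))"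

text \<open>
  The input is promised to be (the code of) a quantifier-free formula over the signature: nothing
  is required of the algorithm on other inputs, as the signature itself may be undecidable.
\<close>

definition decidable :: "'u itself \<Rightarrow> fo_theory \<Rightarrow> bool" where
  "decidable U T \<longleftrightarrow> (\<exists>p. \<forall>\<phi> \<in> qf_fms (sig T).
     computes p [code_fm \<phi>] (if satisfiable U T \<phi> then 1 else 0))"

definition n_decidable :: "'u itself \<Rightarrow> nat \<Rightarrow> fo_theory \<Rightarrow> bool" where
  "n_decidable U n T \<longleftrightarrow> (\<exists>p. \<forall>\<phi> \<in> qf_fms (sig T).
     computes p [code_fm \<phi>] (if enat n \<in> Spec U T \<phi> then 1 else 0))"

definition n_shiny :: "'u itself \<Rightarrow> nat \<Rightarrow> fo_theory \<Rightarrow> bool" where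
  "n_shiny U n T \<longleftrightarrow> decidable U T \<and>
     (\<exists>p. \<forall>\<phi> \<in> qf_fms (sig T). satisfiable U T \<phi> \<longrightarrow>
       (\<exists>t k. computes p [code_fm \<phi>] (prod_encode (t, k)) \<and> t \<in> {0, 1, 2} \<and> k \<ge> 1 \<and>
         (t = 0 \<longrightarrow> Spec U T \<phi> = {enat n}) \<and>
         (t = 1 \<longrightarrow> Spec U T \<phi> = {enat n} \<union> {m. enat k \<le> m}) \<and>
         (t = 2 \<longrightarrow> Spec U T \<phi> = {m. enat k \<le> m})))"

lemma computes_det: "computes p xs y \<Longrightarrow> computes p xs z \<Longrightarrow> y = z"
proof (induction arbitrary: z rule: computes.induct)
  case (Comp ys gs xs f z z')
  from Comp.prems obtain ys' where ys': "length ys' = length gs"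
    "\<And>i. i < length gs \<Longrightarrow> computes (gs ! i) xs (ys' ! i)" "computes f ys' z'"
    by (cases rule: computes.cases) auto
  have "ys = ys'" using Comp ys' by (intro nth_equalityI) auto
  with Comp ys' show ?case by blast
next
  case (PRec_Suc f g k xs y z z')
  from PRec_Suc.prems obtain y' where "computes (PRec f g) (k # xs) y'" "computes g (k # y' # xs) z'"
    by (cases rule: computes.cases) auto
  with PRec_Suc show ?case by blast
next
  case (Mu f k xs z)
  from Mu.prems have z: "computes f (z # xs) 0"
    "\<And>i. i < z \<Longrightarrow> \<exists>y. computes f (i # xs) (Suc y)"
    by (cases rule: computes.cases; auto)+
  show ?case
  proof (rule linorder_cases[of k z])
    assume "k < z"
    then obtain y where "computes f (k # xs) (Suc y)" using z(2) by blast
    then have "0 = Suc y" by (rule Mu.IH(1))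
    then show ?thesis by simp
  next
    assume "z < k"
    then obtain y where "\<forall>u. computes f (z # xs) u \<longrightarrow> Suc y = u" using Mu.IH(2) by blast
    with z(1) have "Suc y = 0" by blast
    then show ?thesis by simp
  qed
next
  case (Zero xs) then show ?case by (cases rule: computes.cases) auto
next
  case (Succ x) then show ?case by (cases rule: computes.cases) auto
next
  case (Proj i xs)
  from Proj.prems show ?case by (cases rule: computes.cases) auto
next
  case (PRec_0 f xs y g)
  from PRec_0.prems have "computes f xs z" by (cases rule: computes.cases) auto
  then show ?case by (rule PRec_0.IH)
qed

lemma code_tm_inj: "code_tm s = code_tm t \<Longrightarrow> s = t"
proof (induction s arbitrary: t)
  case (Var x) then show ?case by (cases t) auto
next
  case (Fun f ts)
  from Fun.prems obtain us where t: "t = Fun f us" and us: "map code_tm ts = map code_tm us"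
    by (cases t) (auto simp: list_encode_eq)
  from us have "ts = us"
    using Fun.IH by (auto simp: list_eq_iff_nth_eq map_equality_iff)
  then show ?case by (simp add: t)
qed

lemma code_fm_inj: "code_fm \<phi> = code_fm \<psi> \<Longrightarrow> \<phi> = \<psi>"
proof (induction \<phi> arbitrary: \<psi>)
  case (Pred p ts)
  have "inj code_tm" by (auto intro: injI code_tm_inj)
  with Pred show ?case by (cases \<psi>) (auto simp: list_encode_eq inj_map_eq_map)
next
  case (Eq s t) then show ?case by (cases \<psi>) (auto dest: code_tm_inj)
next
  case (Neg \<phi>) then show ?case by (cases \<psi>) auto
next
  case (Conj \<phi>1 \<phi>2) then show ?case by (cases \<psi>) auto
next
  case (Disj \<phi>1 \<phi>2) then show ?case by (cases \<psi>) auto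
next
  case (Imp \<phi>1 \<phi>2) then show ?case by (cases \<psi>) auto
next
  case (All x \<phi>) then show ?case by (cases \<psi>) auto
next
  case (Ex x \<phi>) then show ?case by (cases \<psi>) auto
qed

lemma sat_cong_tm: "(\<And>x. x \<in> fv_tm t \<Longrightarrow> v x = w x) \<Longrightarrow> eval_tm M v t = eval_tm M w t"
proof (induction t)
  case (Fun f ts)
  then have "map (eval_tm M v) ts = map (eval_tm M w) ts" by (auto intro!: map_cong)
  then show ?case by (simp only: eval_tm.simps)
qed simp

lemma sat_cong: "(\<And>x. x \<in> fv_fm \<phi> \<Longrightarrow> v x = w x) \<Longrightarrow> sat M v \<phi> = sat M w \<phi>"
proof (induction \<phi> arbitrary: v w)
  case (Eq s t)
  then show ?case using sat_cong_tm[of s v w M] sat_cong_tm[of t v w M] by simp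
next
  case (Pred p ts)
  then have "map (eval_tm M v) ts = map (eval_tm M w) ts"
    by (auto intro!: map_cong sat_cong_tm)
  then show ?case by (simp only: sat.simps)
next
  case (Neg \<phi>)
  have "sat M v \<phi> = sat M w \<phi>" by (rule Neg.IH) (simp add: Neg.prems)
  then show ?case by simp
next
  case (Conj \<phi> \<psi>)
  have "sat M v \<phi> = sat M w \<phi>" by (rule Conj.IH(1)) (simp add: Conj.prems)
  moreover have "sat M v \<psi> = sat M w \<psi>" by (rule Conj.IH(2)) (simp add: Conj.prems)
  ultimately show ?case by simp
next
  case (Disj \<phi> \<psi>)
  have "sat M v \<phi> = sat M w \<phi>" by (rule Disj.IH(1)) (simp add: Disj.prems)
  moreover have "sat M v \<psi> = sat M w \<psi>" by (rule Disj.IH(2)) (simp add: Disj.prems)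
  ultimately show ?case by simp
next
  case (Imp \<phi> \<psi>)
  have "sat M v \<phi> = sat M w \<phi>" by (rule Imp.IH(1)) (simp add: Imp.prems)
  moreover have "sat M v \<psi> = sat M w \<psi>" by (rule Imp.IH(2)) (simp add: Imp.prems)
  ultimately show ?case by simp
next
  case (All x \<phi>)
  have "sat M (v(x := a)) \<phi> = sat M (w(x := a)) \<phi>" for a
    by (rule All.IH) (simp add: All.prems)
  then show ?case by simp
next
  case (Ex x \<phi>)
  have "sat M (v(x := a)) \<phi> = sat M (w(x := a)) \<phi>" for a
    by (rule Ex.IH) (simp add: Ex.prems)
  then show ?case by simp
qed

lemma finite_fv_tm: "finite (fv_tm t)"
  by (induction t) auto

lemma finite_fv_fm: "finite (fv_fm \<phi>)"
  by (induction \<phi>) (auto simp: finite_fv_tm)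

lemma eval_tm_in_domain:
  assumes "is_struct \<Sigma> M" "range v \<subseteq> domain M" "wf_tm \<Sigma> t"
  shows "eval_tm M v t \<in> domain M"
  using assms(3)
proof (induction t)
  case (Fun f ts)
  have "set (map (eval_tm M v) ts) \<subseteq> domain M"
    using Fun by (auto simp: list_all_iff)
  then show ?case using Fun.prems assms(1) by (auto simp: is_struct_def)
qed (use assms in auto)

definition transport :: "('u \<Rightarrow> 'w) \<Rightarrow> 'u fo_struct \<Rightarrow> 'w fo_struct" where
  "transport g M = \<lparr>domain = g ` domain M,
     fint = (\<lambda>f ys. g (fint M f (map (inv_into (domain M) g) ys))),
     pint = (\<lambda>p ys. pint M p (map (inv_into (domain M) g) ys))\<rparr>"

lemma transport_simps:
  "domain (transport g M) = g ` domain M"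
  "fint (transport g M) f ys = g (fint M f (map (inv_into (domain M) g) ys))"
  "pint (transport g M) p ys = pint M p (map (inv_into (domain M) g) ys)"
  by (simp_all add: transport_def)

lemma transport_sat:
  assumes M: "is_struct \<Sigma> M" and g: "inj_on g (domain M)"
  shows "is_struct \<Sigma> (transport g M)"
    and "range v \<subseteq> domain M \<Longrightarrow> wf_fm \<Sigma> \<phi> \<Longrightarrow> sat (transport g M) (g \<circ> v) \<phi> = sat M v \<phi>"
proof -
  show "is_struct \<Sigma> (transport g M)"
    unfolding is_struct_def
  proof (intro conjI ballI allI impI)
    show "domain (transport g M) \<noteq> {}" using M by (simp add: transport_def is_struct_def)
  next
    fix f xs
    assume f: "f \<in> fsyms \<Sigma>" and xs: "length xs = farity \<Sigma> f \<and> set xs \<subseteq> domain (transport g M)"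
    have "set (map (inv_into (domain M) g) xs) \<subseteq> domain M"
      using xs by (auto simp: transport_def intro!: inv_into_into)
    then have "fint M f (map (inv_into (domain M) g) xs) \<in> domain M"
      using M f xs by (simp add: is_struct_def)
    then show "fint (transport g M) f xs \<in> domain (transport g M)"
      by (simp add: transport_def)
  qed
  have tm: "eval_tm (transport g M) (g \<circ> v) t = g (eval_tm M v t)"
    if "range v \<subseteq> domain M" "wf_tm \<Sigma> t" for v t
    using that(2)
  proof (induction t)
    case (Fun f ts)
    have "map (inv_into (domain M) g) (map (eval_tm (transport g M) (g \<circ> v)) ts)
        = map (eval_tm M v) ts"
      unfolding map_map
    proof (rule map_cong[OF refl])
      fix t assume t: "t \<in> set ts"
      then have "wf_tm \<Sigma> t" using Fun.prems by (auto simp: list_all_iff)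
      then show "(inv_into (domain M) g \<circ> eval_tm (transport g M) (g \<circ> v)) t = eval_tm M v t"
        using Fun.IH[OF t] eval_tm_in_domain[OF M that(1)] g by (simp del: o_apply add: o_apply[of _ _ t])
    qed
    then show ?case by (simp only: eval_tm.simps transport_simps)
  qed simp
  have upd: "(g \<circ> v)(x := g a) = g \<circ> v(x := a)" for v x a by auto
  show "range v \<subseteq> domain M \<Longrightarrow> wf_fm \<Sigma> \<phi> \<Longrightarrow> sat (transport g M) (g \<circ> v) \<phi> = sat M v \<phi>"
  proof (induction \<phi> arbitrary: v)
    case (Eq s t)
    then have wf: "wf_tm \<Sigma> s" "wf_tm \<Sigma> t" by simp_all
    show ?case
      using inj_on_eq_iff[OF g] eval_tm_in_domain[OF M Eq.prems(1)] wf
      unfolding sat.simps tm[OF Eq.prems(1) wf(1)] tm[OF Eq.prems(1) wf(2)] by blast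
  next
    case (Pred p ts)
    have "map (inv_into (domain M) g) (map (eval_tm (transport g M) (g \<circ> v)) ts)
        = map (eval_tm M v) ts"
      unfolding map_map
    proof (rule map_cong[OF refl])
      fix t assume t: "t \<in> set ts"
      then have "wf_tm \<Sigma> t" using Pred.prems by (auto simp: list_all_iff)
      then show "(inv_into (domain M) g \<circ> eval_tm (transport g M) (g \<circ> v)) t = eval_tm M v t"
        using tm[OF Pred.prems(1)] eval_tm_in_domain[OF M Pred.prems(1)] g by (simp del: o_apply add: o_apply[of _ _ t])
    qed
    then show ?case by (simp only: sat.simps transport_simps)
  next
    case (All x \<phi>)
    have "sat (transport g M) ((g \<circ> v)(x := g a)) \<phi> = sat M (v(x := a)) \<phi>" if "a \<in> domain M" for a
      unfolding upd using All.prems that by (intro All.IH) auto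
    then show ?case unfolding sat.simps transport_simps by blast
  next
    case (Ex x \<phi>)
    have "sat (transport g M) ((g \<circ> v)(x := g a)) \<phi> = sat M (v(x := a)) \<phi>" if "a \<in> domain M" for a
      unfolding upd using Ex.prems that by (intro Ex.IH) auto
    then show ?case unfolding sat.simps transport_simps by blast
  next
    case (Neg \<phi>) then show ?case unfolding sat.simps wf_fm.simps by blast
  next
    case (Conj \<phi> \<psi>) then show ?case unfolding sat.simps wf_fm.simps by blast
  next
    case (Disj \<phi> \<psi>) then show ?case unfolding sat.simps wf_fm.simps by blast
  next
    case (Imp \<phi> \<psi>) then show ?case unfolding sat.simps wf_fm.simps by blast
  qed
qed

lemma transport_interpretation:
  assumes "is_theory T" "interpretation_of T M v" "inj_on g (domain M)"
  shows "interpretation_of T (transport g M) (g \<circ> v)"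
proof -
  have M: "is_struct (sig T) M" "range v \<subseteq> domain M" "\<And>\<psi>. \<psi> \<in> axioms T \<Longrightarrow> sat M v \<psi>"
    using assms(2) by (auto simp: interpretation_of_def)
  have "sat (transport g M) (g \<circ> v) \<psi>" if "\<psi> \<in> axioms T" for \<psi>
  proof -
    have "wf_fm (sig T) \<psi>" using assms(1) that by (auto simp: is_theory_def sentences_def)
    then show ?thesis using transport_sat(2)[OF M(1) assms(3) M(2)] M(3)[OF that] by blast
  qed
  moreover have "range (g \<circ> v) \<subseteq> domain (transport g M)" using M(2) by (auto simp: transport_simps)
  ultimately show ?thesis
    using transport_sat(1)[OF M(1) assms(3)] unfolding interpretation_of_def by blast
qed

text \<open>
  The values of \<open>skolem_tm\<close> form a countable elementary substructure (Loewenheim-Skolem).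
\<close>

instance tm :: countable by countable_datatype
instance fm :: countable by countable_datatype

datatype skolem_tm = SVar nat | SFun nat "skolem_tm list" | SWit bool fm nat "skolem_tm list"
instance skolem_tm :: countable by countable_datatype

definition witness :: "'u fo_struct \<Rightarrow> (nat \<Rightarrow> 'u) \<Rightarrow> bool \<Rightarrow> fm \<Rightarrow> nat \<Rightarrow> 'u list \<Rightarrow> 'u" where
  "witness M v b \<phi> x ys =
    (let P = (\<lambda>a. a \<in> domain M \<and>
       sat M ((\<lambda>i. if i < length ys then ys ! i else v i)(x := a)) \<phi> = b)
     in if \<exists>a. P a then SOME a. P a else v 0)"

primrec skolem_eval :: "signature \<Rightarrow> 'u fo_struct \<Rightarrow> (nat \<Rightarrow> 'u) \<Rightarrow> skolem_tm \<Rightarrow> 'u" where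
  "skolem_eval \<Sigma> M v (SVar i) = v i"
| "skolem_eval \<Sigma> M v (SFun f ts) =
     (if f \<in> fsyms \<Sigma> \<and> length ts = farity \<Sigma> f then fint M f (map (skolem_eval \<Sigma> M v) ts) else v 0)"
| "skolem_eval \<Sigma> M v (SWit b \<phi> x ts) = witness M v b \<phi> x (map (skolem_eval \<Sigma> M v) ts)"

lemma skolem_hull_list:
  assumes "set ys \<subseteq> range (skolem_eval \<Sigma> M v)"
  obtains ts where "ys = map (skolem_eval \<Sigma> M v) ts"
proof -
  have "ys \<in> lists (range (skolem_eval \<Sigma> M v))" using assms by (auto simp: in_lists_conv_set)
  then show ?thesis using that by (auto simp: lists_image)
qed

lemma skolem_hull:
  fixes M :: "'u fo_struct"
  assumes M: "is_struct \<Sigma> M" and v: "range v \<subseteq> domain M"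
  defines "H \<equiv> range (skolem_eval \<Sigma> M v)"
  shows "H \<subseteq> domain M" "is_struct \<Sigma> (M\<lparr>domain := H\<rparr>)"
    "range w \<subseteq> H \<Longrightarrow> sat (M\<lparr>domain := H\<rparr>) w \<phi> = sat M w \<phi>"
proof -
  have wit_dom: "witness M v b \<phi> x ys \<in> domain M" for b \<phi> x ys
  proof -
    let ?P = "\<lambda>a. a \<in> domain M \<and>
      sat M ((\<lambda>i. if i < length ys then ys ! i else v i)(x := a)) \<phi> = b"
    have "v 0 \<in> domain M" using v by blast
    moreover have "(SOME a. ?P a) \<in> domain M" if "\<exists>a. ?P a" using someI_ex[OF that] by blast
    ultimately show ?thesis unfolding witness_def Let_def by (simp del: fun_upd_apply)
  qed
  have "skolem_eval \<Sigma> M v t \<in> domain M" for t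
  proof (induction t)
    case (SFun f ts)
    have "set (map (skolem_eval \<Sigma> M v) ts) \<subseteq> domain M" using SFun by auto
    moreover have "v 0 \<in> domain M" using v by blast
    ultimately show ?case using M by (auto simp: is_struct_def)
  qed (use v wit_dom in auto)
  then show HM: "H \<subseteq> domain M" by (auto simp: H_def)
  have "fint M f xs \<in> H" if "f \<in> fsyms \<Sigma>" "length xs = farity \<Sigma> f" "set xs \<subseteq> H" for f xs
  proof -
    obtain ts where "xs = map (skolem_eval \<Sigma> M v) ts"
      using skolem_hull_list \<open>set xs \<subseteq> H\<close> unfolding H_def by blast
    then have "fint M f xs = skolem_eval \<Sigma> M v (SFun f ts)" using that by simp
    then show ?thesis unfolding H_def by (simp only: rangeI)
  qed
  then show "is_struct \<Sigma> (M\<lparr>domain := H\<rparr>)"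
    by (auto simp: is_struct_def H_def)
  have wit: "\<exists>a\<in>H. sat M (w(x := a)) \<phi> = b"
    if w: "range w \<subseteq> H" and ex: "a \<in> domain M" "sat M (w(x := a)) \<phi> = b" for w x a b \<phi>
  proof -
    obtain N where N: "\<And>i. i \<in> fv_fm \<phi> \<Longrightarrow> i < N"
      using finite_fv_fm[of \<phi>] unfolding finite_nat_set_iff_bounded by blast
    define ys where "ys = map w [0..<N]"
    have "set ys \<subseteq> H" using w by (auto simp: ys_def)
    then obtain ts where ts: "ys = map (skolem_eval \<Sigma> M v) ts"
      using skolem_hull_list unfolding H_def by blast
    let ?P = "\<lambda>a. a \<in> domain M \<and>
      sat M ((\<lambda>i. if i < length ys then ys ! i else v i)(x := a)) \<phi> = b"
    have eq: "sat M ((\<lambda>i. if i < length ys then ys ! i else v i)(x := a)) \<phi>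
        = sat M (w(x := a)) \<phi>" for a
      by (rule sat_cong) (auto simp: ys_def dest: N)
    have "?P a" using ex eq by simp
    then have "?P (SOME a. ?P a)" by (rule someI)
    moreover have "witness M v b \<phi> x ys = (SOME a. ?P a)"
      using \<open>?P a\<close> unfolding witness_def Let_def by auto
    ultimately have "?P (witness M v b \<phi> x ys)" by simp
    then have "sat M (w(x := witness M v b \<phi> x ys)) \<phi> = b" using eq by simp
    moreover have "witness M v b \<phi> x ys = skolem_eval \<Sigma> M v (SWit b \<phi> x ts)"
      using ts by simp
    then have "witness M v b \<phi> x ys \<in> H" unfolding H_def by blast
    ultimately show ?thesis by blast
  qed
  have tm: "eval_tm (M\<lparr>domain := H\<rparr>) w t = eval_tm M w t" for w t
  proof (induction t)
    case (Fun f ts)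
    then have "map (eval_tm (M\<lparr>domain := H\<rparr>) w) ts = map (eval_tm M w) ts" by simp
    then show ?case by (simp del: map_eq_conv)
  qed simp
  show "range w \<subseteq> H \<Longrightarrow> sat (M\<lparr>domain := H\<rparr>) w \<phi> = sat M w \<phi>"
  proof (induction \<phi> arbitrary: w)
    case (Eq s t) then show ?case by (simp add: tm)
  next
    case (Pred p ts)
    have "map (eval_tm (M\<lparr>domain := H\<rparr>) w) ts = map (eval_tm M w) ts" by (simp add: tm)
    then show ?case by (simp del: map_eq_conv)
  next
    case (All x \<phi>)
    have "sat (M\<lparr>domain := H\<rparr>) (w(x := a)) \<phi> = sat M (w(x := a)) \<phi>" if "a \<in> H" for a
      using All.prems that by (intro All.IH) auto
    then have "sat (M\<lparr>domain := H\<rparr>) w (All x \<phi>) = (\<forall>a\<in>H. sat M (w(x := a)) \<phi>)" by simp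
    also have "\<dots> = sat M w (All x \<phi>)"
      using HM wit[OF All.prems, of _ x \<phi> False] by auto
    finally show ?case .
  next
    case (Ex x \<phi>)
    have "sat (M\<lparr>domain := H\<rparr>) (w(x := a)) \<phi> = sat M (w(x := a)) \<phi>" if "a \<in> H" for a
      using Ex.prems that by (intro Ex.IH) auto
    then have "sat (M\<lparr>domain := H\<rparr>) w (Ex x \<phi>) = (\<exists>a\<in>H. sat M (w(x := a)) \<phi>)" by simp
    also have "\<dots> = sat M w (Ex x \<phi>)"
      using HM wit[OF Ex.prems, of _ x \<phi> True] by auto
    finally show ?case .
  qed auto
qed

lemma countable_inj_into_infinite:
  assumes "countable (A :: 'u set)"
  obtains g :: "'u \<Rightarrow> 'w::infinite" where "inj_on g A"
proof -
  obtain e :: "nat \<Rightarrow> 'w" where "inj e"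
    using infinite_countable_subset[OF infinite_UNIV] by blast
  then have "inj_on (e \<circ> to_nat_on A) A"
    using assms by (intro comp_inj_on inj_on_to_nat_on) (auto intro: inj_on_subset)
  then show ?thesis by (rule that)
qed

lemma satisfiable_universe_aux:
  assumes T: "is_theory T" and \<phi>: "wf_fm (sig T) \<phi>" and "satisfiable TYPE('u) T \<phi>"
  shows "satisfiable TYPE('w::infinite) T \<phi>"
proof -
  obtain M :: "'u fo_struct" and v where Mv: "interpretation_of T M v" "sat M v \<phi>"
    using assms(3) by (auto simp: satisfiable_def)
  then have M: "is_struct (sig T) M" "range v \<subseteq> domain M" by (auto simp: interpretation_of_def)
  define H where "H = range (skolem_eval (sig T) M v)"
  have vH: "range v \<subseteq> H"
  proof
    fix y assume "y \<in> range v"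
    then obtain i where "y = skolem_eval (sig T) M v (SVar i)" by auto
    then show "y \<in> H" unfolding H_def by blast
  qed
  let ?N = "M\<lparr>domain := H\<rparr>"
  note hull = skolem_hull[OF M, folded H_def]
  have N: "interpretation_of T ?N v" "sat ?N v \<phi>"
    using Mv hull vH by (auto simp: interpretation_of_def)
  have "countable (domain ?N)" by (simp add: H_def)
  then obtain g :: "'u \<Rightarrow> 'w" where g: "inj_on g (domain ?N)" by (rule countable_inj_into_infinite)
  have "interpretation_of T (transport g ?N) (g \<circ> v)"
    by (rule transport_interpretation[OF T N(1) g])
  moreover have "sat (transport g ?N) (g \<circ> v) \<phi>"
    using transport_sat(2)[OF hull(2) g _ \<phi>] vH N(2) by simp
  ultimately show ?thesis by (auto simp: satisfiable_def)
qed

lemma satisfiable_universe: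
  assumes "is_theory T" "wf_fm (sig T) \<phi>"
  shows "satisfiable TYPE('u::infinite) T \<phi> \<longleftrightarrow> satisfiable TYPE('w::infinite) T \<phi>"
  using satisfiable_universe_aux[OF assms, where 'u='u and 'w='w]
    satisfiable_universe_aux[OF assms, where 'u='w and 'w='u] by (rule iffI)

lemma has_card_image: "inj_on g A \<Longrightarrow> has_card (g ` A) m = has_card A m"
  by (cases m) (auto simp: card_image finite_image_iff countable_image_inj_eq)

lemma has_card_countable: "has_card A m \<Longrightarrow> countable A"
  by (cases m) (auto intro: countable_finite)

lemma Spec_universe_aux:
  assumes T: "is_theory T" and \<phi>: "wf_fm (sig T) \<phi>"
  shows "Spec TYPE('u) T \<phi> \<subseteq> Spec TYPE('w::infinite) T \<phi>"
proof
  fix m assume "m \<in> Spec TYPE('u) T \<phi>"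
  then obtain M :: "'u fo_struct" and v
    where M: "interpretation_of T M v" "has_card (domain M) m" "sat M v \<phi>"
    by (auto simp: Spec_def)
  obtain g :: "'u \<Rightarrow> 'w" where g: "inj_on g (domain M)"
    using has_card_countable[OF M(2)] by (rule countable_inj_into_infinite)
  have "interpretation_of T (transport g M) (g \<circ> v)"
    by (rule transport_interpretation[OF T M(1) g])
  moreover have "sat (transport g M) (g \<circ> v) \<phi>"
    using transport_sat(2)[OF _ g _ \<phi>] M by (simp add: interpretation_of_def)
  moreover have "has_card (domain (transport g M)) m"
    using has_card_image[OF g] M(2) by (simp add: transport_def)
  ultimately show "m \<in> Spec TYPE('w) T \<phi>" by (auto simp: Spec_def)
qed

lemma Spec_universe:
  assumes "is_theory T" "wf_fm (sig T) \<phi>"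
  shows "Spec TYPE('u::infinite) T \<phi> = Spec TYPE('w::infinite) T \<phi>"
  using Spec_universe_aux[OF assms, where 'u='u and 'w='w]
    Spec_universe_aux[OF assms, where 'u='w and 'w='u] by (rule subset_antisym)

corollary decidable_universe:
  assumes "is_theory T"
  shows "decidable TYPE('u::infinite) T \<longleftrightarrow> decidable TYPE('w::infinite) T"
  using satisfiable_universe[OF assms, where 'u='u and 'w='w]
  by (simp add: decidable_def qf_fms_def)

corollary n_decidable_universe:
  assumes "is_theory T"
  shows "n_decidable TYPE('u::infinite) n T \<longleftrightarrow> n_decidable TYPE('w::infinite) n T"
  using Spec_universe[OF assms, where 'u='u and 'w='w]
  by (simp add: n_decidable_def qf_fms_def)

corollary n_shiny_universe:
  assumes "is_theory T"
  shows "n_shiny TYPE('u::infinite) n T \<longleftrightarrow> n_shiny TYPE('w::infinite) n T"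
  using satisfiable_universe[OF assms, where 'u='u and 'w='w]
    Spec_universe[OF assms, where 'u='u and 'w='w]
  unfolding n_shiny_def decidable_universe[OF assms, where 'u='u and 'w='w]
  by (simp add: qf_fms_def cong: conj_cong imp_cong)

end

theory Submission
  imports Defs
begin

text \<open>
  Let \<open>T'\<close> be the theory over the empty signature whose only axiom says that there are exactly
  \<open>n\<close> elements. Every satisfiable formula has spectrum \<open>{n}\<close> in it, and satisfiability of a pure
  equality formula in an \<open>n\<close>-element set is decided by trying the finitely many assignments of
  its variables; so \<open>T'\<close> is \<open>n\<close>-shiny. A formula over the signature of \<open>T\<close> is satisfiable in the
  combination of \<open>T\<close> and \<open>T'\<close> if and only if it has a model of size \<open>n\<close> in \<open>T\<close>, so the
  decision procedure of the combination, applied to the renamed formula, shows that \<open>T\<close> is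
  \<open>n\<close>-decidable. Unary functions suffice to work with algorithms on codes, thanks to the pairing
  function; renaming and evaluation are course-of-values recursions on codes.
\<close>

section \<open>Total computable functions\<close>

abbreviation pfst :: "nat \<Rightarrow> nat" where
  "pfst z \<equiv> fst (prod_decode z)"

abbreviation psnd :: "nat \<Rightarrow> nat" where
  "psnd z \<equiv> snd (prod_decode z)"

definition computable :: "(nat \<Rightarrow> nat) \<Rightarrow> bool" where
  "computable f \<longleftrightarrow> (\<exists>p. \<forall>x. computes p [x] (f x))"

text \<open>Addition, subtraction and pairing take two arguments; all later functions are unary and
  work on paired codes.\<close>

definition computable2 :: "(nat \<Rightarrow> nat \<Rightarrow> nat) \<Rightarrow> bool" where
  "computable2 f \<longleftrightarrow> (\<exists>p. \<forall>x y. computes p [x, y] (f x y))"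

lemma computes_Proj: "i < length xs \<Longrightarrow> xs ! i = y \<Longrightarrow> computes (Proj i) xs y"
  using computes.Proj by blast

lemma computes_Comp1:
  "computes g xs y \<Longrightarrow> computes f [y] z \<Longrightarrow> computes (Comp f [g]) xs z"
  by (rule computes.Comp[where ys = "[y]"]) auto

lemma computes_Comp2:
  "computes g xs y \<Longrightarrow> computes g' xs y' \<Longrightarrow> computes f [y, y'] z \<Longrightarrow>
    computes (Comp f [g, g']) xs z"
  by (rule computes.Comp[where ys = "[y, y']"]) (auto simp: less_Suc_eq)

lemma computes_PRec:
  assumes "computes b xs B" "\<And>k y. computes g (k # y # xs) (G k y)"
  shows "computes (PRec b g) (k # xs) (rec_nat B G k)"
  by (induction k) (auto intro: computes.intros assms)

lemma computable_comp:
  assumes "computable f" "computable g"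
  shows "computable (\<lambda>x. f (g x))"
proof -
  obtain p q where "\<And>x. computes p [x] (f x)" "\<And>x. computes q [x] (g x)"
    using assms unfolding computable_def by blast
  then have "computes (Comp p [q]) [x] (f (g x))" for x by (intro computes_Comp1)
  then show ?thesis unfolding computable_def by blast
qed

lemma computable_comp2:
  assumes "computable f" "computable2 g"
  shows "computable2 (\<lambda>x y. f (g x y))"
proof -
  obtain p q where "\<And>x. computes p [x] (f x)" "\<And>x y. computes q [x, y] (g x y)"
    using assms unfolding computable_def computable2_def by blast
  then have "computes (Comp p [q]) [x, y] (f (g x y))" for x y by (intro computes_Comp1)
  then show ?thesis unfolding computable2_def by blast
qed

lemma computable2_comp:
  assumes "computable2 f" "computable g" "computable h"
  shows "computable (\<lambda>x. f (g x) (h x))"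
proof -
  obtain p where p: "\<And>x y. computes p [x, y] (f x y)"
    using assms unfolding computable2_def by blast
  obtain q r where "\<And>x. computes q [x] (g x)" "\<And>x. computes r [x] (h x)"
    using assms unfolding computable_def by blast
  with p have "computes (Comp p [q, r]) [x] (f (g x) (h x))" for x by (intro computes_Comp2)
  then show ?thesis unfolding computable_def by blast
qed

lemma computable2_comp2:
  assumes "computable2 f" "computable2 g" "computable2 h"
  shows "computable2 (\<lambda>x y. f (g x y) (h x y))"
proof -
  obtain p where p: "\<And>x y. computes p [x, y] (f x y)"
    using assms unfolding computable2_def by blast
  obtain q r where "\<And>x y. computes q [x, y] (g x y)" "\<And>x y. computes r [x, y] (h x y)"
    using assms unfolding computable2_def by blast
  with p have "computes (Comp p [q, r]) [x, y] (f (g x y) (h x y))" for x y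
    by (intro computes_Comp2)
  then show ?thesis unfolding computable2_def by blast
qed

lemma computable_id: "computable (\<lambda>x. x)"
  unfolding computable_def by (auto intro!: exI[of _ "Proj 0"] computes_Proj)

lemma computable2_proj: "computable2 (\<lambda>x y. x)" "computable2 (\<lambda>x y. y)"
proof -
  have "computes (Proj 0) [x, y] x" "computes (Proj 1) [x, y] y" for x y
    by (simp_all add: computes_Proj)
  then show "computable2 (\<lambda>x y. x)" "computable2 (\<lambda>x y. y)" unfolding computable2_def by blast+
qed

lemma computable_Suc: "computable Suc"
  unfolding computable_def by (auto intro: computes.Succ)

lemma computable_const: "computable (\<lambda>_. c)"
proof (induction c)
  case 0 show ?case unfolding computable_def by (auto intro: computes.Zero)
next
  case (Suc c) then show ?case using computable_comp[OF computable_Suc] by blast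
qed

section \<open>Primitive recursion and basic arithmetic\<close>

text \<open>The step \<open>g\<close> does not see the parameter \<open>x\<close>, which the
  projections drop. This is enough for arithmetic; \<open>computable_rec\<close> lifts the
  restriction once pairing is available.\<close>

lemma computable2_rec:
  assumes "computable b" "computable2 g"
  shows "computable2 (\<lambda>k x. rec_nat (b x) g k)"
proof -
  from assms obtain pb pg where p: "\<And>x. computes pb [x] (b x)" "\<And>x y. computes pg [x, y] (g x y)"
    unfolding computable_def computable2_def by blast
  have "computes (PRec pb (Comp pg [Proj 0, Proj 1])) [k, x] (rec_nat (b x) g k)" for k x
    by (rule computes_PRec[OF p(1)]) (rule computes_Comp2[OF _ _ p(2)]; rule computes_Proj; simp)
  then show ?thesis unfolding computable2_def by blast
qed

lemma computable_rec0:
  assumes "computable2 g"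
  shows "computable (\<lambda>k. rec_nat c g k)"
  using computable2_comp[OF computable2_rec[OF computable_const assms] computable_id computable_id] .

lemma computable2_add: "computable2 (+)"
proof -
  have "rec_nat x (\<lambda>_ y. Suc y) k = k + x" for k x by (induction k) auto
  with computable2_rec[OF computable_id computable_comp2[OF computable_Suc computable2_proj(2)]]
  show ?thesis by simp
qed

lemma computable_pred: "computable (\<lambda>x. x - 1)"
proof -
  have "rec_nat 0 (\<lambda>k _. k) k = k - 1" for k by (cases k) auto
  with computable_rec0[OF computable2_proj(1), of 0] show ?thesis by simp
qed

lemma computable2_sub: "computable2 (-)"
proof -
  have "rec_nat x (\<lambda>_ y. y - 1) k = x - k" for k x by (induction k) auto
  with computable2_rec[OF computable_id computable_comp2[OF computable_pred computable2_proj(2)]]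
  have "computable2 (\<lambda>k x. x - k)" by simp
  \<comment> \<open>The recursion runs over the subtrahend, which therefore came first; the
    projections swap the arguments back.\<close>
  from computable2_comp2[OF this computable2_proj(2,1)] show ?thesis .
qed

lemma computable_triangle: "computable triangle"
proof -
  have "rec_nat 0 (\<lambda>k y. Suc (k + y)) = triangle"
  proof
    show "rec_nat 0 (\<lambda>k y. Suc (k + y)) k = triangle k" for k by (induction k) auto
  qed
  with computable_rec0[OF computable_comp2[OF computable_Suc computable2_add], of 0]
  show ?thesis by simp
qed

section \<open>The pairing function and its inverse\<close>

lemma computable2_prod_encode: "computable2 (\<lambda>x y. prod_encode (x, y))"
  unfolding prod_encode_def prod.case
  by (intro computable2_comp2[OF computable2_add] computable_comp2[OF computable_triangle]
      computable2_proj computable2_add)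

lemma triangle_mono: "m \<le> n \<Longrightarrow> triangle m \<le> triangle n"
  by (induction rule: dec_induct) auto

text \<open>Pairs are numbered diagonal by diagonal, and those with sum \<open>s\<close> fill the
  interval from \<open>triangle s\<close> to just below \<open>triangle (Suc s)\<close>. The sum
  thus becomes accessible to a search.\<close>

lemma prod_encode_diagonal: "pfst z + psnd z = (LEAST s. z < triangle (Suc s))"
proof (rule Least_equality[symmetric])
  obtain a b where ab: "prod_decode z = (a, b)" by fastforce
  then have z: "z = triangle (a + b) + a"
    using prod_decode_inverse[of z] by (simp add: prod_encode_def)
  show "z < triangle (Suc (pfst z + psnd z))" using ab z by simp
  show "pfst z + psnd z \<le> s" if "z < triangle (Suc s)" for s
  proof (rule ccontr)
    assume "\<not> ?thesis"
    then have "triangle (Suc s) \<le> triangle (a + b)" using ab by (intro triangle_mono) simp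
    with that z show False by simp
  qed
qed

lemma computable_diagonal: "computable (\<lambda>z. pfst z + psnd z)"
proof -
  \<comment> \<open>The truncated difference vanishes exactly when
    \<open>z < triangle (Suc s)\<close>, so \<open>Mu\<close> stops at the wanted diagonal.\<close>
  have "computable2 (\<lambda>s z. Suc z - triangle (Suc s))"
    by (intro computable2_comp2[OF computable2_sub] computable_comp2[OF computable_triangle]
        computable_comp2[OF computable_Suc] computable2_proj)
  then obtain p where p: "\<And>s z. computes p [s, z] (Suc z - triangle (Suc s))"
    unfolding computable2_def by blast
  have "computes (Mu p) [z] (pfst z + psnd z)" for z
    unfolding prod_encode_diagonal
  proof (rule computes.Mu)
    have "z < triangle (Suc z)" by simp
    then have "z < triangle (Suc (LEAST s. z < triangle (Suc s)))" by (rule LeastI)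
    then have "Suc z - triangle (Suc (LEAST s. z < triangle (Suc s))) = 0" by linarith
    then show "computes p [LEAST s. z < triangle (Suc s), z] 0" using p by metis
  next
    fix i assume "i < (LEAST s. z < triangle (Suc s))"
    then have "\<not> z < triangle (Suc i)" by (rule not_less_Least)
    then obtain y where "Suc z - triangle (Suc i) = Suc y" by (metis Suc_diff_le not_less)
    then show "\<exists>y. computes p [i, z] (Suc y)" using p by metis
  qed
  then show ?thesis unfolding computable_def by blast
qed

lemma computable_prod_decode: "computable (\<lambda>z. pfst z)" "computable (\<lambda>z. psnd z)"
proof -
  have fst: "z - triangle (pfst z + psnd z) = pfst z" for z
  proof -
    have "triangle (pfst z + psnd z) + pfst z = prod_encode (prod_decode z)"
      unfolding prod_encode_def case_prod_unfold ..
    also have "\<dots> = z" by (rule prod_decode_inverse)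
    finally show ?thesis by linarith
  qed
  have "computable (\<lambda>z. z - triangle (pfst z + psnd z))"
    by (intro computable2_comp[OF computable2_sub] computable_comp[OF computable_triangle]
        computable_id computable_diagonal)
  then show *: "computable (\<lambda>z. pfst z)" unfolding fst .
  have "computable (\<lambda>z. (pfst z + psnd z) - pfst z)"
    by (intro computable2_comp[OF computable2_sub] computable_diagonal *)
  then show "computable (\<lambda>z. psnd z)" by simp
qed

section \<open>Closure rules for unary computable functions\<close>

named_theorems computable_intros

lemmas [computable_intros] = computable_id computable_const
  computable_comp[OF computable_Suc] computable2_comp[OF computable2_add]
  computable2_comp[OF computable2_sub] computable2_comp[OF computable2_prod_encode]
  computable_comp[OF computable_prod_decode(1)] computable_comp[OF computable_prod_decode(2)]

text \<open>Here the step may depend on \<open>x\<close> too: counter, previous value and parameter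
  are packed into the single argument \<open>z\<close>.\<close>

lemma computable_rec [computable_intros]:
  assumes "computable b" "computable m"
    and "computable (\<lambda>z. g (pfst z) (pfst (psnd z)) (psnd (psnd z)))"
  shows "computable (\<lambda>x. rec_nat (b x) (\<lambda>k y. g k y x) (m x))"
proof -
  from assms(1,2) obtain pb pm
    where p: "\<And>x. computes pb [x] (b x)" "\<And>x. computes pm [x] (m x)"
    unfolding computable_def by blast
  from assms(3) obtain pg
    where pg: "\<And>z. computes pg [z] (g (pfst z) (pfst (psnd z)) (psnd (psnd z)))"
    unfolding computable_def by blast
  obtain e where e: "\<And>x y. computes e [x, y] (prod_encode (x, y))"
    using computable2_prod_encode unfolding computable2_def by blast
  let ?s = "Comp pg [Comp e [Proj 0, Comp e [Proj 1, Proj 2]]]"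
  have "computes ?s [k, y, x] (g k y x)" for k y x
  proof (rule computes_Comp1)
    show "computes (Comp e [Proj 0, Comp e [Proj 1, Proj 2]]) [k, y, x]
        (prod_encode (k, prod_encode (y, x)))"
      by (rule computes_Comp2[OF _ computes_Comp2[OF _ _ e] e]; rule computes_Proj; simp)
    show "computes pg [prod_encode (k, prod_encode (y, x))] (g k y x)"
      using pg[of "prod_encode (k, prod_encode (y, x))"] by simp
  qed
  then have "computes (PRec pb ?s) [k, x] (rec_nat (b x) (\<lambda>k y. g k y x) k)" for k x
    by (intro computes_PRec p(1))
  then have "computes (Comp (PRec pb ?s) [pm, Proj 0]) [x] (rec_nat (b x) (\<lambda>k y. g k y x) (m x))" for x
    by (intro computes_Comp2[OF p(2) computes_Proj[of 0 _ x]]) simp_all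
  then show ?thesis unfolding computable_def by blast
qed

text \<open>Case distinction is a recursion whose step ignores the previous value: any positive
  counter yields \<open>b x\<close>.\<close>

lemma computable_if_zero [computable_intros]:
  assumes "computable e" "computable a" "computable b"
  shows "computable (\<lambda>x. if e x = 0 then a x else b x)"
proof -
  have "(if e x = 0 then a x else b x) = rec_nat (a x) (\<lambda>_ _. b x) (e x)" for x
    by (cases "e x") auto
  moreover have "computable (\<lambda>x. rec_nat (a x) (\<lambda>_ _. b x) (e x))"
    by (intro computable_intros assms computable_comp[OF assms(3)])
  ultimately show ?thesis by simp
qed

lemma computable_if_eq [computable_intros]:
  assumes "computable e" "computable f" "computable a" "computable b"
  shows "computable (\<lambda>x. if e x = f x then a x else b x)"
proof -
  have "computable (\<lambda>x. if (e x - f x) + (f x - e x) = 0 then a x else b x)"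
    by (intro computable_intros assms)
  moreover have "(e x - f x) + (f x - e x) = 0 \<longleftrightarrow> e x = f x" for x by auto
  ultimately show ?thesis by (simp only:)
qed

lemma computable_mult_const: "computable (\<lambda>x. n * x)"
proof -
  have "rec_nat 0 (\<lambda>_ y. n + y) x = n * x" for x by (induction x) auto
  moreover have "computable (\<lambda>x. rec_nat 0 (\<lambda>_ y. n + y) x)" by (intro computable_intros)
  ultimately show ?thesis by simp
qed

text \<open>A counter that wraps around at \<open>n\<close>; for \<open>n = 0\<close> it never
  wraps, in agreement with \<open>x mod 0 = x\<close>.\<close>

lemma computable_mod_const: "computable (\<lambda>x. x mod n)"
proof -
  have "rec_nat 0 (\<lambda>_ y. if Suc y = n then 0 else Suc y) x = x mod n" for x
    by (induction x) (auto simp: mod_Suc)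
  moreover have "computable (\<lambda>x. rec_nat 0 (\<lambda>_ y. if Suc y = n then 0 else Suc y) x)"
    by (intro computable_intros)
  ultimately show ?thesis by simp
qed

text \<open>The quotient grows exactly when the step from \<open>k\<close> to \<open>Suc k\<close>
  reaches a multiple of \<open>n\<close>.\<close>

lemma computable_div_const: "computable (\<lambda>x. x div n)"
proof -
  have "rec_nat 0 (\<lambda>k y. if Suc (k mod n) = n then Suc y else y) x = x div n" for x
    by (induction x) (auto simp: div_Suc mod_Suc)
  moreover have "computable (\<lambda>x. rec_nat 0 (\<lambda>k y. if Suc (k mod n) = n then Suc y else y) x)"
    by (intro computable_intros computable_comp[OF computable_mod_const])
  ultimately show ?thesis by simp
qed

lemma computable_bounded_ex:
  assumes "computable b" "computable (\<lambda>z. f (pfst z) (psnd z))"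
  shows "computable (\<lambda>x. if \<exists>a < b x. f a x \<noteq> 0 then 1 else 0)"
proof -
  have "rec_nat (0::nat) (\<lambda>a y. if f a x = 0 then y else 1) m = (if \<exists>a < m. f a x \<noteq> 0 then 1 else 0)"
    for x m by (induction m) (auto simp: less_Suc_eq)
  moreover have "computable (\<lambda>x. rec_nat 0 (\<lambda>a y. if f a x = 0 then y else 1) (b x))"
  proof (intro computable_intros assms(1))
    \<comment> \<open>The body receives the triple of \<open>a\<close>, the flag so far and
      \<open>x\<close>; pairing \<open>a\<close> with \<open>x\<close> anew skips the flag.\<close>
    have "computable (\<lambda>z. f (pfst (prod_encode (pfst z, psnd (psnd z))))
        (psnd (prod_encode (pfst z, psnd (psnd z)))))"
      by (rule computable_comp[OF assms(2)]) (intro computable_intros)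
    then show "computable (\<lambda>z. f (pfst z) (psnd (psnd z)))" by simp
  qed
  ultimately show ?thesis by (simp only:)
qed

section \<open>Course-of-values recursion\<close>

text \<open>
  The history of the values below \<open>x\<close> is the code of the list of these values, latest first, so
  that the value at \<open>i\<close> is found after dropping \<open>x - 1 - i\<close> elements.
\<close>

definition lookup :: "nat \<Rightarrow> nat \<Rightarrow> nat \<Rightarrow> nat" where
  "lookup h x i = pfst (rec_nat h (\<lambda>_ y. psnd (y - 1)) (x - 1 - i) - 1)"

definition hist :: "(nat \<Rightarrow> nat \<Rightarrow> (nat \<Rightarrow> nat) \<Rightarrow> nat) \<Rightarrow> nat \<Rightarrow> nat \<Rightarrow> nat" where
  "hist F a x = rec_nat 0 (\<lambda>k h. Suc (prod_encode (F a k (lookup h k), h))) x"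

text \<open>The parameter \<open>a\<close> is constant during the recursion: it carries the coded
  assignment in evaluation and is \<open>0\<close> in renaming. The last argument of
  \<open>F\<close> can be trusted only below \<open>x\<close>.\<close>

definition covrec :: "(nat \<Rightarrow> nat \<Rightarrow> (nat \<Rightarrow> nat) \<Rightarrow> nat) \<Rightarrow> nat \<Rightarrow> nat \<Rightarrow> nat" where
  "covrec F a x = F a x (lookup (hist F a x) x)"

lemma hist_Suc: "hist F a (Suc x) = Suc (prod_encode (covrec F a x, hist F a x))"
  by (simp add: hist_def covrec_def)

lemma lookup_hist:
  assumes "i < x"
  shows "lookup (hist F a x) x i = covrec F a i"
proof -
  have drop: "rec_nat (hist F a x) (\<lambda>_ y. psnd (y - 1)) k = hist F a (x - k)" if "k \<le> x" for k
    using that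
  proof (induction k)
    case (Suc k)
    then have "x - k = Suc (x - Suc k)" by simp
    with Suc show ?case by (simp add: hist_Suc)
  qed simp
  \<comment> \<open>What remains after dropping is the history below \<open>Suc i\<close>, whose
    head is the value at \<open>i\<close>.\<close>
  have "x - (x - 1 - i) = Suc i" using assms by simp
  then show ?thesis using drop[of "x - 1 - i"] by (simp add: lookup_def hist_Suc)
qed

lemma computable_lookup [computable_intros]:
  assumes "computable h" "computable x" "computable i"
  shows "computable (\<lambda>z. lookup (h z) (x z) (i z))"
  unfolding lookup_def by (intro computable_intros assms)

text \<open>A program cannot receive the function argument of \<open>F\<close>, so computability is
  required with lookups in a coded history in its place; \<open>z\<close> packs parameter, position
  and history.\<close>

lemma computable_covrec:
  assumes "computable (\<lambda>z. F (pfst z) (pfst (psnd z)) (lookup (psnd (psnd z)) (pfst (psnd z))))"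
    and "computable f" "computable g"
  shows "computable (\<lambda>x. covrec F (f x) (g x))"
proof -
  have step: "computable (\<lambda>z. F (a z) (k z) (lookup (h z) (k z)))"
    if "computable a" "computable k" "computable h" for a k h
  proof -
    have "computable (\<lambda>z. prod_encode (a z, prod_encode (k z, h z)))"
      by (intro computable_intros that)
    from computable_comp[OF assms(1) this] show ?thesis by simp
  qed
  have "computable (\<lambda>x. hist F (f x) (g x))"
    unfolding hist_def
    by (intro computable_intros step assms computable_comp[OF assms(2)])
  then show ?thesis unfolding covrec_def by (intro step assms)
qed

text \<open>Positive constructor tags make the codes of subexpressions strictly smaller, as lookups
  require. Tag \<open>0\<close> would not do, since \<open>prod_encode (0, 0) = 0\<close>.\<close>

lemma less_prod_encode: "1 \<le> a \<Longrightarrow> b < prod_encode (a, b)"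
proof -
  have "n \<le> triangle n" for n by (induction n) auto
  then have "a + b \<le> triangle (a + b)" .
  then show "1 \<le> a \<Longrightarrow> b < prod_encode (a, b)" by (simp add: prod_encode_def)
qed

lemma less_prod_encode_pair:
  assumes "1 \<le> a"
  shows "b < prod_encode (a, prod_encode (b, c))" "c < prod_encode (a, prod_encode (b, c))"
  using less_prod_encode[OF assms, of "prod_encode (b, c)"] le_prod_encode_1[of b c]
    le_prod_encode_2[of c b] by linarith+

section \<open>Renaming on codes\<close>

text \<open>The second component renames codes of lists of terms.\<close>

definition rename_tm_step :: "nat \<Rightarrow> nat \<Rightarrow> (nat \<Rightarrow> nat) \<Rightarrow> nat" where
  "rename_tm_step _ x r = prod_encode
     (if pfst x = 0 then x
      else prod_encode (1, prod_encode (pfst (psnd x) + pfst (psnd x), psnd (r (psnd (psnd x))))),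
      if x = 0 then 0
      else Suc (prod_encode (pfst (r (pfst (x - 1))), psnd (r (psnd (x - 1))))))"

abbreviation rename_tm_code :: "nat \<Rightarrow> nat" where
  "rename_tm_code \<equiv> covrec rename_tm_step 0"

text \<open>Doubling a symbol is \<open>inj_left\<close>. All tags from \<open>3\<close> on are
  treated as binary connectives, which is wrong for quantifiers; hence \<open>rename_fm_code\<close>
  assumes quantifier-freeness.\<close>

definition rename_fm_step :: "nat \<Rightarrow> nat \<Rightarrow> (nat \<Rightarrow> nat) \<Rightarrow> nat" where
  "rename_fm_step _ x r =
     (if pfst x = 0 then prod_encode (0, prod_encode
        (pfst (rename_tm_code (pfst (psnd x))), pfst (rename_tm_code (psnd (psnd x)))))
      else if pfst x = 1 then prod_encode (1, prod_encode
        (pfst (psnd x) + pfst (psnd x), psnd (rename_tm_code (psnd (psnd x)))))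
      else if pfst x = 2 then prod_encode (2, r (psnd x))
      else prod_encode (pfst x, prod_encode (r (pfst (psnd x)), r (psnd (psnd x)))))"

abbreviation rename_fm_code :: "nat \<Rightarrow> nat" where
  "rename_fm_code \<equiv> covrec rename_fm_step 0"

lemma computable_rename_tm_code: "computable rename_tm_code"
  by (rule computable_covrec[of _ "\<lambda>_. 0" "\<lambda>x. x"]; (unfold rename_tm_step_def)?; intro computable_intros)

lemma computable_rename_fm_code: "computable rename_fm_code"
  by (rule computable_covrec[of _ "\<lambda>_. 0" "\<lambda>x. x"]; (unfold rename_fm_step_def)?;
      intro computable_intros computable_comp[OF computable_rename_tm_code])

lemma inj_left_eq: "inj_left k = k + k"
  by (simp add: inj_left_def sum_encode_def)

text \<open>The term case is a hypothesis, so that the lemma can be applied inside the induction on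
  terms, to the induction hypothesis for the arguments.\<close>

lemma rename_tm_code_list:
  assumes "\<And>t. t \<in> set ts \<Longrightarrow> pfst (rename_tm_code (code_tm t)) = code_tm (rename_tm inj_left t)"
  shows "psnd (rename_tm_code (list_encode (map code_tm ts)))
    = list_encode (map code_tm (map (rename_tm inj_left) ts))"
  using assms
proof (induction ts)
  case Nil show ?case by (simp add: covrec_def rename_tm_step_def)
next
  case (Cons t ts)
  let ?a = "code_tm t" and ?b = "list_encode (map code_tm ts)"
  \<comment> \<open>The \<open>Suc\<close> in \<open>list_encode\<close> plays the part of a
    positive tag.\<close>
  have "?a < Suc (prod_encode (?a, ?b))" "?b < Suc (prod_encode (?a, ?b))"
    using le_prod_encode_1[of ?a ?b] le_prod_encode_2[of ?b ?a] by simp_all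
  then have "psnd (rename_tm_code (Suc (prod_encode (?a, ?b))))
      = Suc (prod_encode (pfst (rename_tm_code ?a), psnd (rename_tm_code ?b)))"
    by (subst covrec_def) (simp add: rename_tm_step_def lookup_hist)
  then show ?case using Cons by simp
qed

lemma rename_tm_code: "pfst (rename_tm_code (code_tm t)) = code_tm (rename_tm inj_left t)"
proof (induction t)
  case (Var x) show ?case by (simp add: covrec_def rename_tm_step_def)
next
  case (Fun f ts)
  let ?l = "list_encode (map code_tm ts)"
  have "pfst (rename_tm_code (prod_encode (1, prod_encode (f, ?l))))
      = prod_encode (1, prod_encode (f + f, psnd (rename_tm_code ?l)))"
    using less_prod_encode_pair(2)[of 1 ?l f]
    by (subst covrec_def) (simp add: rename_tm_step_def lookup_hist)
  then show ?case using rename_tm_code_list[OF Fun, of ts] by (simp add: inj_left_eq[of f])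
qed

lemma rename_fm_code:
  "quantifier_free \<phi> \<Longrightarrow> rename_fm_code (code_fm \<phi>) = code_fm (rename_fm inj_left \<phi>)"
proof (induction \<phi>)
  case (Eq s t)
  show ?case by (subst covrec_def) (simp add: rename_fm_step_def rename_tm_code)
next
  case (Pred p ts)
  show ?case using rename_tm_code_list[OF rename_tm_code, of ts]
    by (subst covrec_def) (simp add: rename_fm_step_def inj_left_eq[of p])
next
  case (Neg \<phi>)
  have "rename_fm_code (prod_encode (2, code_fm \<phi>)) = prod_encode (2, rename_fm_code (code_fm \<phi>))"
    by (subst covrec_def, subst rename_fm_step_def) (simp add: lookup_hist less_prod_encode)
  then show ?case using Neg by simp
next
  case (Conj \<phi> \<psi>)
  then show ?case
    by (subst covrec_def, subst rename_fm_step_def) (simp add: lookup_hist less_prod_encode_pair)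
next
  case (Disj \<phi> \<psi>)
  then show ?case
    by (subst covrec_def, subst rename_fm_step_def) (simp add: lookup_hist less_prod_encode_pair)
next
  case (Imp \<phi> \<psi>)
  then show ?case
    by (subst covrec_def, subst rename_fm_step_def) (simp add: lookup_hist less_prod_encode_pair)
qed simp_all


section \<open>Pure equality formulas over a set of given size\<close>

definition pure_sig :: signature where
  "pure_sig = \<lparr>fsyms = {}, farity = (\<lambda>_. 0), psyms = {}, parity = (\<lambda>_. 0)\<rparr>"

lemma wf_tm_pure: "wf_tm pure_sig t \<longleftrightarrow> (\<exists>x. t = Var x)"
  by (cases t) (auto simp: pure_sig_def)

text \<open>Without symbols and quantifiers, truth depends only on which variables share a value, so
  \<open>M\<close> and \<open>M'\<close> may be any structures, even over different types.\<close>

lemma sat_pure_inj: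
  assumes "inj_on g (range v)" "wf_fm pure_sig \<phi>" "quantifier_free \<phi>"
  shows "sat M' (g \<circ> v) \<phi> = sat M v \<phi>"
  using assms(2,3)
proof (induction \<phi>)
  case (Eq s t)
  then obtain x y where "s = Var x" "t = Var y" by (auto simp: wf_tm_pure)
  then show ?case using assms(1) by (auto simp: inj_on_eq_iff)
qed (auto simp: pure_sig_def)

text \<open>Gives a computable bound on the number of digits that an assignment needs.\<close>

lemma fv_le_code_pure:
  assumes "wf_fm pure_sig \<phi>" "quantifier_free \<phi>" "x \<in> fv_fm \<phi>"
  shows "x \<le> code_fm \<phi>"
  using assms
proof (induction \<phi>)
  case (Eq s t)
  then obtain y z where st: "s = Var y" "t = Var z" by (auto simp: wf_tm_pure)
  have "y \<le> code_tm s" "z \<le> code_tm t" using st by (simp_all add: le_prod_encode_2)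
  moreover have "code_tm s \<le> code_fm (Eq s t)" "code_tm t \<le> code_fm (Eq s t)"
    using le_prod_encode_1[of "code_tm s" "code_tm t"] le_prod_encode_2[of "code_tm t" "code_tm s"]
      le_prod_encode_2[of "prod_encode (code_tm s, code_tm t)" 0] by simp_all
  ultimately show ?case using Eq.prems(3) st by auto
next
  case (Neg \<phi>)
  then have "x \<le> code_fm \<phi>" by simp
  then show ?case using le_prod_encode_2[of "code_fm \<phi>" 2] by simp
next
  case (Conj \<phi> \<psi>)
  then have "x \<le> code_fm \<phi> \<or> x \<le> code_fm \<psi>" by auto
  then show ?case using less_prod_encode_pair(1)[of 3 "code_fm \<phi>" "code_fm \<psi>"]
      less_prod_encode_pair(2)[of 3 "code_fm \<psi>" "code_fm \<phi>"] by auto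
next
  case (Disj \<phi> \<psi>)
  then have "x \<le> code_fm \<phi> \<or> x \<le> code_fm \<psi>" by auto
  then show ?case using less_prod_encode_pair(1)[of 4 "code_fm \<phi>" "code_fm \<psi>"]
      less_prod_encode_pair(2)[of 4 "code_fm \<psi>" "code_fm \<phi>"] by auto
next
  case (Imp \<phi> \<psi>)
  then have "x \<le> code_fm \<phi> \<or> x \<le> code_fm \<psi>" by auto
  then show ?case using less_prod_encode_pair(1)[of 5 "code_fm \<phi>" "code_fm \<psi>"]
      less_prod_encode_pair(2)[of 5 "code_fm \<psi>" "code_fm \<phi>"] by auto
qed (auto simp: pure_sig_def)

text \<open>The base-\<open>n\<close> digits of a number encode an assignment of values below \<open>n\<close>.\<close>

definition digit :: "nat \<Rightarrow> nat \<Rightarrow> nat \<Rightarrow> nat" where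
  "digit n a x = rec_nat a (\<lambda>_ y. y div n) x mod n"

lemma digit_Suc: "digit n a (Suc x) = digit n (a div n) x"
proof -
  have "rec_nat a (\<lambda>_ y. y div n) (Suc x) = rec_nat (a div n) (\<lambda>_ y. y div n) x"
    by (induction x) auto
  then show ?thesis by (simp only: digit_def)
qed

lemma ex_digits:
  assumes "\<And>x. w x < n"
  shows "\<exists>a < n ^ N. \<forall>x < N. digit n a x = w x"
  using assms
proof (induction N arbitrary: w)
  case (Suc N)
  obtain a where a: "a < n ^ N" "\<And>x. x < N \<Longrightarrow> digit n a x = w (Suc x)"
    using Suc.IH[of "\<lambda>x. w (Suc x)"] Suc.prems by blast
  have w0: "w 0 < n" by (rule Suc.prems)
  \<comment> \<open>The value at \<open>0\<close> becomes the lowest digit, and the digits of the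
    shifted assignment move up one place.\<close>
  have "w 0 + n * a < n * Suc a" using w0 by simp
  also have "\<dots> \<le> n * n ^ N" using a(1) by (intro mult_le_mono2) simp
  finally have "w 0 + n * a < n ^ Suc N" by simp
  moreover have "digit n (w 0 + n * a) x = w x" if "x < Suc N" for x
    using that w0 a(2) by (cases x) (simp_all add: digit_Suc, simp add: digit_def)
  ultimately show ?case by blast
qed simp

text \<open>Terms are variables here, with their index as second component of the code. The final
  branch is implication, the one connective left in pure quantifier-free formulas.\<close>

definition eval_step :: "nat \<Rightarrow> nat \<Rightarrow> nat \<Rightarrow> (nat \<Rightarrow> nat) \<Rightarrow> nat" where
  "eval_step n a x r =
     (if pfst x = 0 then
        if digit n a (psnd (pfst (psnd x))) = digit n a (psnd (psnd (psnd x))) then 1 else 0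
      else if pfst x = 2 then 1 - r (psnd x)
      else if pfst x = 3 then if r (pfst (psnd x)) = 0 then 0 else r (psnd (psnd x))
      else if pfst x = 4 then if r (pfst (psnd x)) = 0 then r (psnd (psnd x)) else 1
      else if r (pfst (psnd x)) = 0 then 1 else r (psnd (psnd x)))"

lemma computable_digit:
  assumes "computable a" "computable x"
  shows "computable (\<lambda>z. digit n (a z) (x z))"
  unfolding digit_def
  by (intro computable_intros assms computable_comp[OF computable_mod_const]
      computable_comp[OF computable_div_const])

lemma computable_eval:
  assumes "computable f" "computable g"
  shows "computable (\<lambda>z. covrec (eval_step n) (f z) (g z))"
  by (rule computable_covrec[OF _ assms], unfold eval_step_def)
    (intro computable_intros computable_digit)

lemma eval_code:
  assumes "wf_fm pure_sig \<phi>" "quantifier_free \<phi>"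
  shows "covrec (eval_step n) a (code_fm \<phi>) = (if sat M (digit n a) \<phi> then 1 else 0)"
  using assms
proof (induction \<phi>)
  case (Eq s t)
  then obtain x y where "s = Var x" "t = Var y" by (auto simp: wf_tm_pure)
  then show ?case by (subst covrec_def) (simp add: eval_step_def)
next
  case (Neg \<phi>)
  then show ?case by (subst covrec_def, subst eval_step_def) (simp add: lookup_hist less_prod_encode)
next
  case (Conj \<phi> \<psi>)
  then show ?case by (subst covrec_def, subst eval_step_def) (simp add: lookup_hist less_prod_encode_pair)
next
  case (Disj \<phi> \<psi>)
  then show ?case by (subst covrec_def, subst eval_step_def) (simp add: lookup_hist less_prod_encode_pair)
next
  case (Imp \<phi> \<psi>)
  then show ?case by (subst covrec_def, subst eval_step_def) (simp add: lookup_hist less_prod_encode_pair)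
qed (auto simp: pure_sig_def)

section \<open>The theory of sets of given size\<close>

primrec exs :: "nat \<Rightarrow> fm \<Rightarrow> fm" where
  "exs 0 \<phi> = \<phi>"
| "exs (Suc k) \<phi> = exs k (Ex k \<phi>)"

text \<open>An equation stands in for truth. Its variable \<open>0\<close> is bound by
  \<open>exs n\<close> in \<open>card_fm\<close> only if \<open>n \<ge> 1\<close>, whence that
  assumption in \<open>is_theory_card_theory\<close>.\<close>

definition conjs :: "fm list \<Rightarrow> fm" where
  "conjs \<phi>s = foldr Conj \<phi>s (Eq (Var 0) (Var 0))"

definition disjs :: "fm list \<Rightarrow> fm" where
  "disjs \<phi>s = foldr Disj \<phi>s (Neg (Eq (Var 0) (Var 0)))"

definition card_fm :: "nat \<Rightarrow> fm" where
  "card_fm n = exs n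
     (Conj (conjs [Neg (Eq (Var i) (Var j)). j \<leftarrow> [0..<n], i \<leftarrow> [0..<j]])
       (All n (disjs [Eq (Var n) (Var i). i \<leftarrow> [0..<n]])))"

definition card_theory :: "nat \<Rightarrow> fo_theory" where
  "card_theory n = \<lparr>sig = pure_sig, axioms = {card_fm n}\<rparr>"

lemma sat_conjs: "sat M v (conjs \<phi>s) \<longleftrightarrow> (\<forall>\<phi> \<in> set \<phi>s. sat M v \<phi>)"
  by (induction \<phi>s) (auto simp: conjs_def)

lemma sat_disjs: "sat M v (disjs \<phi>s) \<longleftrightarrow> (\<exists>\<phi> \<in> set \<phi>s. sat M v \<phi>)"
  by (induction \<phi>s) (auto simp: disjs_def)

lemma fv_conjs: "fv_fm (conjs \<phi>s) = {0} \<union> (\<Union>\<phi> \<in> set \<phi>s. fv_fm \<phi>)"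
  by (induction \<phi>s) (auto simp: conjs_def)

lemma fv_disjs: "fv_fm (disjs \<phi>s) = {0} \<union> (\<Union>\<phi> \<in> set \<phi>s. fv_fm \<phi>)"
  by (induction \<phi>s) (auto simp: disjs_def)

lemma wf_conjs: "wf_fm \<Sigma> (conjs \<phi>s) \<longleftrightarrow> (\<forall>\<phi> \<in> set \<phi>s. wf_fm \<Sigma> \<phi>)"
  by (induction \<phi>s) (auto simp: conjs_def)

lemma wf_disjs: "wf_fm \<Sigma> (disjs \<phi>s) \<longleftrightarrow> (\<forall>\<phi> \<in> set \<phi>s. wf_fm \<Sigma> \<phi>)"
  by (induction \<phi>s) (auto simp: disjs_def)

lemma wf_exs: "wf_fm \<Sigma> (exs k \<phi>) \<longleftrightarrow> wf_fm \<Sigma> \<phi>"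
  by (induction k arbitrary: \<phi>) auto

lemma fv_exs: "fv_fm (exs k \<phi>) = fv_fm \<phi> - {..<k}"
  by (induction k arbitrary: \<phi>) auto

lemma sat_exs:
  "sat M v (exs k \<phi>) \<longleftrightarrow>
    (\<exists>w. (\<forall>i<k. w i \<in> domain M) \<and> (\<forall>i\<ge>k. w i = v i) \<and> sat M w \<phi>)"
proof (induction k arbitrary: \<phi>)
  case 0
  have "(\<forall>i. w i = v i) \<longleftrightarrow> w = v" for w by auto
  then show ?case by simp
next
  case (Suc k)
  have "(\<exists>w. (\<forall>i<k. w i \<in> domain M) \<and> (\<forall>i\<ge>k. w i = v i) \<and> sat M w (Ex k \<phi>)) \<longleftrightarrow>
    (\<exists>w. (\<forall>i<Suc k. w i \<in> domain M) \<and> (\<forall>i\<ge>Suc k. w i = v i) \<and> sat M w \<phi>)" (is "?L \<longleftrightarrow> ?R")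
  proof
    assume ?L
    then obtain w a where "\<forall>i<k. w i \<in> domain M" "\<forall>i\<ge>k. w i = v i" "a \<in> domain M"
      "sat M (w(k := a)) \<phi>" by auto
    then show ?R by (intro exI[of _ "w(k := a)"]) (auto simp: less_Suc_eq)
  next
    assume ?R
    then obtain w where w: "\<forall>i<Suc k. w i \<in> domain M" "\<forall>i\<ge>Suc k. w i = v i" "sat M w \<phi>" by blast
    \<comment> \<open>\<open>?L\<close> demands agreement with \<open>v\<close> at \<open>k\<close>,
      so \<open>w\<close> is reset there and its old value becomes the witness for
      \<open>Ex k\<close>.\<close>
    have "sat M ((w(k := v k))(k := w k)) \<phi>" using w(3) by simp
    moreover have "w k \<in> domain M" using w(1) by simp
    ultimately have "sat M (w(k := v k)) (Ex k \<phi>)" unfolding sat.simps by blast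
    moreover have "\<forall>i<k. (w(k := v k)) i \<in> domain M" "\<forall>i\<ge>k. (w(k := v k)) i = v i"
      using w(1,2) by (auto simp: Suc_le_eq)
    ultimately show ?L by blast
  qed
  then show ?case unfolding exs.simps Suc.IH .
qed

text \<open>The values of the \<open>n\<close> quantified variables enumerate the domain without
  repetition.\<close>

lemma sat_card_fm: "sat M v (card_fm n) \<longleftrightarrow> finite (domain M) \<and> card (domain M) = n"
proof
  assume "sat M v (card_fm n)"
  then obtain w where w: "\<forall>i<n. w i \<in> domain M" "\<forall>j<n. \<forall>i<j. w i \<noteq> w j"
    "\<forall>a\<in>domain M. \<exists>i<n. a = w i"
    unfolding card_fm_def sat_exs by (fastforce simp: sat_conjs sat_disjs)
  have "domain M = w ` {..<n}" using w(1,3) by auto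
  moreover have "inj_on w {..<n}"
    using w(2) by (intro linorder_inj_onI) auto
  ultimately show "finite (domain M) \<and> card (domain M) = n" by (simp add: card_image)
next
  assume "finite (domain M) \<and> card (domain M) = n"
  then obtain h where h: "bij_betw h {0..<n} (domain M)" using ex_bij_betw_nat_finite by blast
  define w where "w = (\<lambda>i. if i < n then h i else v i)"
  have "\<forall>i<n. w i \<in> domain M" "\<forall>i\<ge>n. w i = v i"
    using bij_betwE[OF h] by (auto simp: w_def)
  moreover have "w i \<noteq> w j" if "j < n" "i < j" for i j
    using inj_on_eq_iff[OF bij_betw_imp_inj_on[OF h], of i j] that by (simp add: w_def)
  moreover have "\<exists>i<n. a = w i" if "a \<in> domain M" for a
    using bij_betw_imp_surj_on[OF h] that by (force simp: w_def)
  ultimately show "sat M v (card_fm n)"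
    unfolding card_fm_def sat_exs by (intro exI[of _ w]) (fastforce simp: sat_conjs sat_disjs)
qed

lemma is_theory_card_theory:
  assumes "n \<ge> 1"
  shows "is_theory (card_theory n)"
proof -
  have "wf_fm pure_sig (card_fm n)"
    by (auto simp: card_fm_def wf_exs wf_conjs wf_disjs)
  moreover have "fv_fm (card_fm n) = {}"
    using assms by (auto simp: card_fm_def fv_exs fv_conjs fv_disjs)
  ultimately show ?thesis by (simp add: is_theory_def card_theory_def sentences_def)
qed

lemma interpretation_card_theory:
  "interpretation_of (card_theory n) M v \<longleftrightarrow>
    range v \<subseteq> domain M \<and> finite (domain M) \<and> card (domain M) = n"
  by (auto simp: interpretation_of_def card_theory_def is_struct_def pure_sig_def sat_card_fm)

text \<open>Up to a bijection the domain consists of the numbers below \<open>n\<close>, which turns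
  satisfiability into a bounded search over coded assignments.\<close>

lemma satisfiable_card_theory:
  assumes n: "n \<ge> 1" and \<phi>: "\<phi> \<in> qf_fms pure_sig"
  shows "satisfiable TYPE('u::infinite) (card_theory n) \<phi> \<longleftrightarrow>
    (\<exists>a < n ^ Suc (code_fm \<phi>). covrec (eval_step n) a (code_fm \<phi>) \<noteq> 0)" (is "?L \<longleftrightarrow> ?R")
proof
  have wf: "wf_fm pure_sig \<phi>" "quantifier_free \<phi>" using \<phi> by (auto simp: qf_fms_def)
  {
    assume ?L
    then obtain M :: "'u fo_struct" and v where M: "range v \<subseteq> domain M" "finite (domain M)"
      "card (domain M) = n" "sat M v \<phi>"
      by (auto simp: satisfiable_def interpretation_card_theory)
    then obtain g where g: "bij_betw g (domain M) {0..<n}"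
      using ex_bij_betw_finite_nat by blast
    have "(g \<circ> v) x < n" for x using bij_betwE[OF g] M(1) by auto
    then obtain a where a: "a < n ^ Suc (code_fm \<phi>)"
      "\<And>x. x < Suc (code_fm \<phi>) \<Longrightarrow> digit n a x = (g \<circ> v) x"
      using ex_digits by blast
    have "inj_on g (range v)" using bij_betw_imp_inj_on[OF g] M(1) by (rule inj_on_subset)
    then have "sat N (g \<circ> v) \<phi>" for N :: "nat fo_struct"
      using sat_pure_inj[OF _ wf] M(4) by blast
    \<comment> \<open>The two assignments agree up to the code of the formula, which covers all its
      variables.\<close>
    moreover have "sat N (digit n a) \<phi> = sat N (g \<circ> v) \<phi>" for N
      using fv_le_code_pure[OF wf] a(2) by (intro sat_cong) (simp add: less_Suc_eq_le)
    ultimately have "covrec (eval_step n) a (code_fm \<phi>) \<noteq> 0"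
      by (simp add: eval_code[OF wf, of n a undefined])
    with a(1) show ?R by blast
  }
  {
    assume ?R
    then obtain a where a: "sat (undefined :: nat fo_struct) (digit n a) \<phi>"
      using eval_code[OF wf, of n _ undefined] by (metis zero_neq_one)
    obtain e :: "nat \<Rightarrow> 'u" where e: "inj e"
      using infinite_countable_subset[OF infinite_UNIV] by blast
    let ?M = "\<lparr>domain = e ` {..<n}, fint = undefined, pint = undefined\<rparr>"
    \<comment> \<open>Digits are remainders modulo \<open>n\<close>, hence below \<open>n\<close>
      because \<open>n \<ge> 1\<close>.\<close>
    have "range (e \<circ> digit n a) \<subseteq> domain ?M" using n by (auto simp: digit_def)
    moreover have "card (domain ?M) = n"
      using inj_on_subset[OF e] by (simp add: card_image)
    ultimately have "interpretation_of (card_theory n) ?M (e \<circ> digit n a)"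
      by (simp add: interpretation_card_theory)
    moreover have "sat ?M (e \<circ> digit n a) \<phi>"
      using sat_pure_inj[OF _ wf] inj_on_subset[OF e] a by blast
    ultimately show ?L unfolding satisfiable_def by blast
  }
qed

lemma decidable_card_theory:
  assumes "n \<ge> 1"
  shows "decidable TYPE('u::infinite) (card_theory n)"
proof -
  have "rec_nat 1 (\<lambda>_ y. n * y) k = n ^ k" for k by (induction k) auto
  moreover have "computable (\<lambda>c. rec_nat 1 (\<lambda>_ y. n * y) (Suc c))"
    by (intro computable_intros computable_comp[OF computable_mult_const])
  ultimately have "computable (\<lambda>c. n ^ Suc c)" by (simp only:)
  then have "computable
      (\<lambda>c. if \<exists>a < n ^ Suc c. covrec (eval_step n) a c \<noteq> 0 then 1 else 0)"
    by (rule computable_bounded_ex) (intro computable_eval computable_intros)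
  then obtain p where p: "\<And>c. computes p [c]
      (if \<exists>a < n ^ Suc c. covrec (eval_step n) a c \<noteq> 0 then 1 else 0)"
    unfolding computable_def by blast
  have "computes p [code_fm \<phi>] (if satisfiable TYPE('u) (card_theory n) \<phi> then 1 else 0)"
    if "\<phi> \<in> qf_fms (sig (card_theory n))" for \<phi>
  proof -
    have "\<phi> \<in> qf_fms pure_sig" using that by (simp add: card_theory_def)
    from satisfiable_card_theory[OF assms this, where 'u = 'u] show ?thesis
      using p[of "code_fm \<phi>"] by (simp only:)
  qed
  then show ?thesis unfolding decidable_def by blast
qed

lemma Spec_card_theory:
  assumes "satisfiable TYPE('u) (card_theory n) \<phi>"
  shows "Spec TYPE('u) (card_theory n) \<phi> = {enat n}"
proof -
  have "has_card (domain M) m \<longleftrightarrow> m = enat n" if "interpretation_of (card_theory n) M v"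
    for M :: "'u fo_struct" and v m
    using that by (cases m) (auto simp: interpretation_card_theory)
  then show ?thesis using assms unfolding Spec_def satisfiable_def by blast
qed

lemma n_shiny_card_theory:
  assumes "n \<ge> 1"
  shows "n_shiny TYPE('u::infinite) n (card_theory n)"
proof -
  \<comment> \<open>A constant answer is correct: type \<open>0\<close> for the spectrum
    \<open>{enat n}\<close>, with \<open>1\<close> as a legal \<open>k\<close>.\<close>
  obtain p where p: "\<And>c. computes p [c] (prod_encode (0, 1))"
    using computable_const[of "prod_encode (0, 1)"] unfolding computable_def by blast
  have "\<exists>t k. computes p [code_fm \<phi>] (prod_encode (t, k)) \<and> t \<in> {0, 1, 2} \<and> k \<ge> 1 \<and>
      (t = 0 \<longrightarrow> Spec TYPE('u) (card_theory n) \<phi> = {enat n}) \<and>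
      (t = 1 \<longrightarrow> Spec TYPE('u) (card_theory n) \<phi> = {enat n} \<union> {m. enat k \<le> m}) \<and>
      (t = 2 \<longrightarrow> Spec TYPE('u) (card_theory n) \<phi> = {m. enat k \<le> m})"
    if "satisfiable TYPE('u) (card_theory n) \<phi>" for \<phi>
    by (rule exI[of _ 0], rule exI[of _ 1]) (use p in \<open>simp add: Spec_card_theory[OF that]\<close>)
  then show ?thesis
    unfolding n_shiny_def using decidable_card_theory[OF assms, where 'u = 'u] by blast
qed

section \<open>Combination with the theory of sets of given size\<close>

text \<open>Moves a renaming from formulas to structures. With \<open>inj_left\<close> it restricts
  a model of the combination to the symbols of the first theory.\<close>

definition reduct :: "(nat \<Rightarrow> nat) \<Rightarrow> 'u fo_struct \<Rightarrow> 'u fo_struct" where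
  "reduct r M = \<lparr>domain = domain M, fint = (\<lambda>f. fint M (r f)), pint = (\<lambda>p. pint M (r p))\<rparr>"

lemma domain_reduct: "domain (reduct r M) = domain M"
  by (simp add: reduct_def)

lemma eval_rename_tm: "eval_tm M v (rename_tm r t) = eval_tm (reduct r M) v t"
proof (induction t)
  case (Fun f ts)
  then have "map (eval_tm M v) (map (rename_tm r) ts) = map (eval_tm (reduct r M) v) ts" by simp
  then show ?case by (simp only: rename_tm.simps eval_tm.simps) (simp add: reduct_def)
qed simp

lemma sat_rename_fm: "sat M v (rename_fm r \<phi>) = sat (reduct r M) v \<phi>"
proof (induction \<phi> arbitrary: v)
  case (Pred p ts)
  have "map (eval_tm M v) (map (rename_tm r) ts) = map (eval_tm (reduct r M) v) ts"
    by (simp add: eval_rename_tm)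
  then show ?case by (simp only: rename_fm.simps sat.simps) (simp add: reduct_def)
qed (simp_all add: eval_rename_tm domain_reduct)

text \<open>The second signature is empty, so only symbols of \<open>T\<close> constrain the
  structure, and \<open>card_fm n\<close> speaks of the domain alone even after renaming.\<close>

lemma interpretation_combination:
  "interpretation_of (T \<squnion> card_theory n) M v \<longleftrightarrow>
    interpretation_of T (reduct inj_left M) v \<and> has_card (domain M) (enat n)"
proof -
  have "is_struct (disjoint_sig \<Sigma> pure_sig) M \<longleftrightarrow> is_struct \<Sigma> (reduct inj_left M)" for \<Sigma>
    by (simp add: is_struct_def disjoint_sig_def pure_sig_def reduct_def inj_left_def)
  then show ?thesis
    by (auto simp: interpretation_of_def disjoint_combination_def card_theory_def sat_rename_fm
        sat_card_fm domain_reduct)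
qed

lemma satisfiable_combination:
  "satisfiable TYPE('u) (T \<squnion> card_theory n) (rename_fm inj_left \<phi>) \<longleftrightarrow>
    enat n \<in> Spec TYPE('u) T \<phi>" (is "?L \<longleftrightarrow> ?R")
proof
  assume ?L
  then obtain M :: "'u fo_struct" and v where "interpretation_of T (reduct inj_left M) v"
    "has_card (domain (reduct inj_left M)) (enat n)" "sat (reduct inj_left M) v \<phi>"
    by (auto simp: satisfiable_def interpretation_combination sat_rename_fm domain_reduct)
  then show ?R unfolding Spec_def by blast
next
  assume ?R
  then obtain M :: "'u fo_struct" and v
    where M: "interpretation_of T M v" "has_card (domain M) (enat n)" "sat M v \<phi>"
    unfolding Spec_def by blast
  \<comment> \<open>Halving inverts \<open>inj_left\<close>, so every structure arises as such a
    reduct; odd symbols lie outside the combined signature.\<close>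
  have "reduct inj_left (reduct (\<lambda>k. k div 2) M) = M"
    by (simp add: reduct_def inj_left_def sum_encode_def)
  then have "interpretation_of (T \<squnion> card_theory n) (reduct (\<lambda>k. k div 2) M) v"
    "sat (reduct (\<lambda>k. k div 2) M) v (rename_fm inj_left \<phi>)"
    using M by (simp_all add: interpretation_combination sat_rename_fm domain_reduct)
  then show ?L unfolding satisfiable_def by blast
qed

lemma wf_rename_tm: "wf_tm \<Sigma> t \<Longrightarrow> wf_tm (disjoint_sig \<Sigma> \<Sigma>') (rename_tm inj_left t)"
  by (induction t) (auto simp: disjoint_sig_def inj_left_def list_all_iff)

lemma wf_rename_fm: "wf_fm \<Sigma> \<phi> \<Longrightarrow> wf_fm (disjoint_sig \<Sigma> \<Sigma>') (rename_fm inj_left \<phi>)"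
  by (induction \<phi>) (auto simp: wf_rename_tm list_all_iff, auto simp: disjoint_sig_def inj_left_def)

lemma quantifier_free_rename_fm: "quantifier_free (rename_fm r \<phi>) = quantifier_free \<phi>"
  by (induction \<phi>) auto

theorem theorem5p17:
  fixes n :: nat and T :: fo_theory
  assumes "n \<ge> 1"
    and "is_theory T"
    and "decidable TYPE('u::infinite) T"
    and "\<And>T'. is_theory T' \<Longrightarrow> decidable TYPE('u) T' \<Longrightarrow> n_shiny TYPE('u) n T'
           \<Longrightarrow> decidable TYPE('u) (T \<squnion> T')"
  shows "n_decidable TYPE('u) n T"
proof -
  have "decidable TYPE('u) (T \<squnion> card_theory n)"
    using assms(1)
    by (intro assms(4) is_theory_card_theory decidable_card_theory n_shiny_card_theory)
  then obtain p where p: "\<And>\<phi>. \<phi> \<in> qf_fms (sig (T \<squnion> card_theory n)) \<Longrightarrow>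
      computes p [code_fm \<phi>] (if satisfiable TYPE('u) (T \<squnion> card_theory n) \<phi> then 1 else 0)"
    unfolding decidable_def by blast
  obtain q where q: "\<And>c. computes q [c] (rename_fm_code c)"
    using computable_rename_fm_code unfolding computable_def by blast
  have "computes (Comp p [q]) [code_fm \<phi>] (if enat n \<in> Spec TYPE('u) T \<phi> then 1 else 0)"
    if \<phi>: "\<phi> \<in> qf_fms (sig T)" for \<phi>
  proof (rule computes_Comp1)
    show "computes q [code_fm \<phi>] (code_fm (rename_fm inj_left \<phi>))"
      using q[of "code_fm \<phi>"] \<phi> by (simp add: qf_fms_def rename_fm_code)
    have "rename_fm inj_left \<phi> \<in> qf_fms (sig (T \<squnion> card_theory n))"
      using \<phi> by (simp add: qf_fms_def disjoint_combination_def wf_rename_fm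
          quantifier_free_rename_fm)
    from p[OF this] show "computes p [code_fm (rename_fm inj_left \<phi>)]
        (if enat n \<in> Spec TYPE('u) T \<phi> then 1 else 0)"
      by (simp only: satisfiable_combination)
  qed
  then show ?thesis unfolding n_decidable_def by blast
qed

end
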